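(* Consider a deterministic walk in a deterministic environment (DWDE) on $\mathbb{Z}$ as in the context. Suppose that the DWDE satisfies the Linkage Property, has uniformly bounded jumps and an ergodic and stationary environment, and that the deterministic environment $(f_i)_{i\in\mathbb{Z}}$ is i.i.d. (under $P$) and such that $$P(f_i=g)=P(f_i=-g)$$ for all transition functions $g\in G$ and all $i\in\mathbb{Z}$. Then the DWDE is transitive on $\mathbb{Z}$.
   Context: Base map. A non-singular transformation $T$ of a measure space $(X,m)$ is Markov with (countable) measurable Markov partition $\beta$ of $X$ if for every $a\in\beta$, $T(a)$ is a union of elements of $\beta$ and $T|_a:a\to T(a)$ is a bijection. $n$-cylinders (cylinders of rank $n$) are the sets $[a_0,\dots,a_{n-1}]:=\bigcap_{j=0}^{n-1}T^{-j}a_j$ with $a_j\in\beta$; $\beta_n$ is the collection of all $n$-cylinders; $|a|$ is the rank of a cylinder $a$; a cylinder is admissible if it has positive measure. For $a\in\beta_n$ let $v'_a$ be the Radon-Nikodym derivative with $\int_{T^na\cap B}v'_a\,dm=m(a\cap T^{-n}B)$ for every measurable $B$. $T$ has the Strong Distortion Property if there is $D\ge1$ such that for all $n\ge1$, $a\in\beta_n$ and a.e. $x,y\in T^na$, $v'_a(x)/v'_a(y)\le D$. $T$ has the Big Image Property if $\inf_{a\in\beta}m(Ta)>0$. Standing assumptions: $T$ is a Markov transformation of a probability space $(X,m)$ with Markov partition $\beta$, having the Strong Distortion and Big Image Properties, and $\beta$ separates points (for all $x\ne y$ in $X$ there are $n\ge1$ and $a,b\in\beta_n$ with $a\cap b=\emptyset$,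 $x\in a$, $y\in b$). Environment. $G$ is a set of functions $g:X\to\mathbb{Z}$ constant on elements of $\beta$. $\eta:\Omega\to\Omega$ is an invertible measurable transformation of a probability space $(\Omega,P)$ and $\phi:\Omega\to G$ is measurable, where $G$ carries the Borel $\sigma$-algebra of the following topology: discrete if $\beta$ is finite; if $\beta=\{a_n\}_{n\ge1}$ is infinite, the topology of the metric $d(f,g)=(1/2)^{S(f,g)}$, $S(f,g)=\max\{n\ge0:f(a_j)=g(a_j)\text{ for }1\le j\le n\}$ ($d(f,f)=0$). Each $\omega$ encodes the environment $(f_i)_{i\in\mathbb{Z}}$, $f_i:=\phi(\eta^i\omega)$. The environment is ergodic and stationary if $\eta$ preserves $P$ and is ergodic. DWDE. The skew-product is $T_f=T_{f(\omega)}:(x,i)\mapsto(Tx,i+f_i(x))$ on $X\times\mathbb{Z}$; the DWDE is $U_{i,n}(x,\omega):=\pi_2(T^n_{f(\omega)}(x,i))$, where $\pi_2(x,y)=y$. Put $\mu:=m\times$ counting measure and $\tilde\beta:=\beta\times\mathbb{Z}$ (partition into sets $a\times\{i\}$; for such a set $\pi_2(a\times\{i\}):=i$). Cylinders of $T_f$ are taken with respect to $\tilde\beta$, and measured with $\mu$. For fixed $\omega$, $a\in\tilde\beta$ communicates with $b\in\tilde\beta$ if $\mu(\{z\in a:T_f^nz\in b\text{ for some }n\ge1\})>0$; $\tilde\beta$ is irreducible under $T_f$ if every two elements communicate with each other. The DWDE is irreducible if this holds for $P$-a.e. $\omega$. For cylinders $v_1,\dots,v_k$ of $T_f$, $v_1\cdot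 v_2\cdots v_k:=v_1\cap T_f^{-|v_1|}(v_2\cap T_f^{-|v_2|}(\dots(T_f^{-|v_{k-1}|}(v_k))\dots))$. The DWDE has the Linkage Property if it is irreducible and there is $r>0$ such that for almost every environment and all $a,b\in\tilde\beta$ with $|\pi_2(a)-\pi_2(b)|=1$, either $b\subset T_f(a)$, or there is a cylinder $c$ with $\mu(c)\ge r$ and $a\cdot c\cdot b$ admissible. The DWDE has uniformly bounded jumps if there is a finite set $J\subset\mathbb{Z}$ with $g(X)\subset J$ for all $g\in G$. The DWDE is transitive on $\mathbb{Z}$ if for $P$-a.e. $\omega$ and all $i,j\in\mathbb{Z}$, $m(\{x\in X:U_{i,n}(x,\omega)=j\text{ for some }n\ge1\})=1$.
   Formalization: The symmetry P(f_i=g)=P(f_i=-g) is required for Borel sets of transition functions, P(f_i∈A)=P(f_i∈-A), not only single g; for non-atomic laws (infinite β) the single-g condition is vacuous and the claim fails; for countable G the two agree. *)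

theory Defs
  imports "HOL-Probability.Probability"
begin

section \<open>Markov maps\<close>

definition cylinders :: "'a set \<Rightarrow> ('a \<Rightarrow> 'a) \<Rightarrow> 'a set set \<Rightarrow> nat \<Rightarrow> 'a set set" where
  "cylinders X T \<beta> n = {{x \<in> X. \<forall>j<n. (T ^^ j) x \<in> a j} | a. \<forall>j<n. a j \<in> \<beta>}"

text \<open>The same set may be a cylinder of several ranks, so the factors of a product
  \<open>v\<^sub>1 \<cdot> v\<^sub>2 \<cdots> v\<^sub>k\<close> are given together with their ranks, as pairs \<open>(v, |v|)\<close>.\<close>

fun cylinder_product :: "'a set \<Rightarrow> ('a \<Rightarrow> 'a) \<Rightarrow> ('a set \<times> nat) list \<Rightarrow> 'a set" where
  "cylinder_product X T [] = X"
| "cylinder_product X T ((v, n) # vs) = v \<inter> (T ^^ n) -` cylinder_product X T vs"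

definition nonsingular :: "'x measure \<Rightarrow> ('x \<Rightarrow> 'x) \<Rightarrow> bool" where
  "nonsingular M T \<longleftrightarrow> T \<in> measurable M M \<and>
     (\<forall>A\<in>sets M. emeasure M (T -` A \<inter> space M) = 0 \<longleftrightarrow> emeasure M A = 0)"

definition markov_partition :: "'x measure \<Rightarrow> ('x \<Rightarrow> 'x) \<Rightarrow> 'x set set \<Rightarrow> bool" where
  "markov_partition M T \<beta> \<longleftrightarrow>
     countable \<beta> \<and> \<beta> \<subseteq> sets M \<and> partition_on (space M) \<beta> \<and>
     (\<forall>a\<in>\<beta>. (\<exists>S\<subseteq>\<beta>. T ` a = \<Union>S) \<and> inj_on T a)"

text \<open>The derivative \<open>v'\<^sub>a\<close> of an \<open>n\<close>-cylinder \<open>a\<close>: the measure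
  \<open>distr (density M (indicator a)) M (T ^^ n)\<close> maps \<open>B\<close> to \<open>m (a \<inter> T\<^sup>-\<^sup>n B)\<close>.\<close>

definition cylinder_deriv :: "'x measure \<Rightarrow> ('x \<Rightarrow> 'x) \<Rightarrow> nat \<Rightarrow> 'x set \<Rightarrow> 'x \<Rightarrow> ennreal" where
  "cylinder_deriv M T n a = RN_deriv M (distr (density M (indicator a)) M (T ^^ n))"

text \<open>The quotient is taken in \<^typ>\<open>ennreal\<close>, where \<open>0 / 0 = 0\<close> and \<open>c / 0 = \<infinity>\<close> for \<open>c > 0\<close>;
  hence null cylinders impose no condition.\<close>

definition strong_distortion :: "'x measure \<Rightarrow> ('x \<Rightarrow> 'x) \<Rightarrow> 'x set set \<Rightarrow> bool" where
  "strong_distortion M T \<beta> \<longleftrightarrow>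
     (\<exists>D::real. D \<ge> 1 \<and> (\<forall>n\<ge>1. \<forall>a\<in>cylinders (space M) T \<beta> n.
        AE x in M. AE y in M. x \<in> (T ^^ n) ` a \<longrightarrow> y \<in> (T ^^ n) ` a \<longrightarrow>
          cylinder_deriv M T n a x / cylinder_deriv M T n a y \<le> ennreal D))"

definition big_image :: "'x measure \<Rightarrow> ('x \<Rightarrow> 'x) \<Rightarrow> 'x set set \<Rightarrow> bool" where
  "big_image M T \<beta> \<longleftrightarrow> (INF a\<in>\<beta>. measure M (T ` a)) > 0"

definition separates_points :: "'x set \<Rightarrow> ('x \<Rightarrow> 'x) \<Rightarrow> 'x set set \<Rightarrow> bool" where
  "separates_points X T \<beta> \<longleftrightarrow> (\<forall>x\<in>X. \<forall>y\<in>X. x \<noteq> y \<longrightarrow>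
     (\<exists>n\<ge>1. \<exists>a\<in>cylinders X T \<beta> n. \<exists>b\<in>cylinders X T \<beta> n. a \<inter> b = {} \<and> x \<in> a \<and> y \<in> b))"

locale markov_map = prob_space M for M :: "'x measure" +
  fixes T :: "'x \<Rightarrow> 'x" and \<beta> :: "'x set set"
  assumes nonsingular: "nonsingular M T"
    and markov_partition: "markov_partition M T \<beta>"
    and strong_distortion: "strong_distortion M T \<beta>"
    and big_image: "big_image M T \<beta>"
    and separates_points: "separates_points (space M) T \<beta>"

section \<open>Transition functions\<close>

text \<open>A function \<open>X \<rightarrow> \<int>\<close> is represented by its extension with \<^const>\<open>undefined\<close> outside \<open>X\<close>, so that
  equality of transition functions is equality on \<open>X\<close>.\<close>

definition transition_functions :: "'x set \<Rightarrow> 'x set set \<Rightarrow> ('x \<Rightarrow> int) set" where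
  "transition_functions X \<beta> = {g \<in> extensional X. \<forall>a\<in>\<beta>. g constant_on a}"

definition neg_on :: "'x set \<Rightarrow> ('x \<Rightarrow> int) \<Rightarrow> 'x \<Rightarrow> int" where
  "neg_on X g = (\<lambda>x\<in>X. - g x)"

text \<open>Here \<open>\<alpha> 1, \<alpha> 2, \<dots>\<close> enumerates \<open>\<beta>\<close>. For distinct transition functions \<open>f\<close> and \<open>g\<close>
  the set of which the maximum is taken is finite.\<close>

definition transition_dist :: "(nat \<Rightarrow> 'x set) \<Rightarrow> ('x \<Rightarrow> int) \<Rightarrow> ('x \<Rightarrow> int) \<Rightarrow> real" where
  "transition_dist \<alpha> f g =
     (if f = g then 0 else (1/2) ^ Max {n. \<forall>j\<in>{1..n}. \<forall>x\<in>\<alpha> j. f x = g x})"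

definition transition_topology ::
    "'x set set \<Rightarrow> (nat \<Rightarrow> 'x set) \<Rightarrow> ('x \<Rightarrow> int) set \<Rightarrow> ('x \<Rightarrow> int) topology" where
  "transition_topology \<beta> \<alpha> G =
     (if finite \<beta> then discrete_topology G else Metric_space.mtopology G (transition_dist \<alpha>))"

definition transition_borel ::
    "'x set set \<Rightarrow> (nat \<Rightarrow> 'x set) \<Rightarrow> ('x \<Rightarrow> int) set \<Rightarrow> ('x \<Rightarrow> int) measure" where
  "transition_borel \<beta> \<alpha> G = sigma G {U. openin (transition_topology \<beta> \<alpha> G) U}"

section \<open>The environment\<close>

definition invertible_transformation :: "'w measure \<Rightarrow> ('w \<Rightarrow> 'w) \<Rightarrow> bool" where
  "invertible_transformation P \<eta> \<longleftrightarrow> \<eta> \<in> measurable P P \<and> bij_betw \<eta> (space P) (space P) \<and>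
     inv_into (space P) \<eta> \<in> measurable P P"

definition int_iterate :: "'w set \<Rightarrow> ('w \<Rightarrow> 'w) \<Rightarrow> int \<Rightarrow> 'w \<Rightarrow> 'w" where
  "int_iterate W \<eta> i = (if i \<ge> 0 then \<eta> ^^ nat i else inv_into W \<eta> ^^ nat (- i))"

definition env :: "'w measure \<Rightarrow> ('w \<Rightarrow> 'w) \<Rightarrow> ('w \<Rightarrow> 'x \<Rightarrow> int) \<Rightarrow> 'w \<Rightarrow> int \<Rightarrow> 'x \<Rightarrow> int" where
  "env P \<eta> \<phi> \<omega> i = \<phi> (int_iterate (space P) \<eta> i \<omega>)"

definition stationary_env :: "'w measure \<Rightarrow> ('w \<Rightarrow> 'w) \<Rightarrow> bool" where
  "stationary_env P \<eta> \<longleftrightarrow> distr P P \<eta> = P"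

definition ergodic_env :: "'w measure \<Rightarrow> ('w \<Rightarrow> 'w) \<Rightarrow> bool" where
  "ergodic_env P \<eta> \<longleftrightarrow>
     (\<forall>A\<in>sets P. \<eta> -` A \<inter> space P = A \<longrightarrow> measure P A = 0 \<or> measure P A = 1)"

definition iid_env ::
    "'x set set \<Rightarrow> (nat \<Rightarrow> 'x set) \<Rightarrow> ('x \<Rightarrow> int) set \<Rightarrow>
     'w measure \<Rightarrow> ('w \<Rightarrow> 'w) \<Rightarrow> ('w \<Rightarrow> 'x \<Rightarrow> int) \<Rightarrow> bool" where
  "iid_env \<beta> \<alpha> G P \<eta> \<phi> \<longleftrightarrow>
     prob_space.indep_vars P (\<lambda>_. transition_borel \<beta> \<alpha> G) (\<lambda>i \<omega>. env P \<eta> \<phi> \<omega> i) (UNIV :: int set) \<and>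
     (\<forall>i j. distr P (transition_borel \<beta> \<alpha> G) (\<lambda>\<omega>. env P \<eta> \<phi> \<omega> i) =
            distr P (transition_borel \<beta> \<alpha> G) (\<lambda>\<omega>. env P \<eta> \<phi> \<omega> j))"

text \<open>Symmetry of the law of each \<open>f\<^sub>i\<close>. The law may be non-atomic when \<open>\<beta>\<close> is infinite, and then
  \<open>P(f\<^sub>i = g) = P(f\<^sub>i = -g)\<close> says nothing for single \<open>g\<close>; so the identity is required for Borel sets
  of transition functions. See \<open>symmetric_env_imp_pointwise\<close> and \<open>symmetric_env_iff_pointwise\<close> below
  for the relation with single \<open>g\<close>.\<close>

definition symmetric_env ::
    "'x set \<Rightarrow> 'x set set \<Rightarrow> (nat \<Rightarrow> 'x set) \<Rightarrow> ('x \<Rightarrow> int) set \<Rightarrow>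
     'w measure \<Rightarrow> ('w \<Rightarrow> 'w) \<Rightarrow> ('w \<Rightarrow> 'x \<Rightarrow> int) \<Rightarrow> bool" where
  "symmetric_env X \<beta> \<alpha> G P \<eta> \<phi> \<longleftrightarrow>
     (\<forall>i. \<forall>A\<in>sets (transition_borel \<beta> \<alpha> G).
        measure P {\<omega> \<in> space P. env P \<eta> \<phi> \<omega> i \<in> A} =
        measure P {\<omega> \<in> space P. env P \<eta> \<phi> \<omega> i \<in> neg_on X ` A})"

section \<open>Deterministic walks in deterministic environments\<close>

locale dwde = markov_map M T \<beta> + env: prob_space P
  for M :: "'x measure" and T :: "'x \<Rightarrow> 'x" and \<beta> :: "'x set set" and P :: "'w measure" +
  fixes \<alpha> :: "nat \<Rightarrow> 'x set" and G :: "('x \<Rightarrow> int) set"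
    and \<eta> :: "'w \<Rightarrow> 'w" and \<phi> :: "'w \<Rightarrow> 'x \<Rightarrow> int"
  assumes enumeration: "infinite \<beta> \<Longrightarrow> bij_betw \<alpha> {1..} \<beta>"
    and transition_functions: "G \<subseteq> transition_functions (space M) \<beta>"
    and invertible: "invertible_transformation P \<eta>"
    and measurable_env: "\<phi> \<in> measurable P (transition_borel \<beta> \<alpha> G)"

definition skew_product :: "('x \<Rightarrow> 'x) \<Rightarrow> (int \<Rightarrow> 'x \<Rightarrow> int) \<Rightarrow> 'x \<times> int \<Rightarrow> 'x \<times> int" where
  "skew_product T f = (\<lambda>(x, i). (T x, i + f i x))"

definition walk :: "('x \<Rightarrow> 'x) \<Rightarrow> (int \<Rightarrow> 'x \<Rightarrow> int) \<Rightarrow> int \<Rightarrow> nat \<Rightarrow> 'x \<Rightarrow> int" where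
  "walk T f i n x = snd ((skew_product T f ^^ n) (x, i))"

definition lifted_measure :: "'x measure \<Rightarrow> ('x \<times> int) measure" where
  "lifted_measure M = M \<Otimes>\<^sub>M count_space UNIV"

definition lifted_partition :: "'x set set \<Rightarrow> ('x \<times> int) set set" where
  "lifted_partition \<beta> = {a \<times> {i} | a i. a \<in> \<beta>}"

definition communicates ::
    "'x measure \<Rightarrow> ('x \<Rightarrow> 'x) \<Rightarrow> (int \<Rightarrow> 'x \<Rightarrow> int) \<Rightarrow> ('x \<times> int) set \<Rightarrow> ('x \<times> int) set \<Rightarrow> bool" where
  "communicates M T f a b \<longleftrightarrow>
     emeasure (lifted_measure M) {z \<in> a. \<exists>n\<ge>1. (skew_product T f ^^ n) z \<in> b} > 0"

definition irreducible_dwde ::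
    "'x measure \<Rightarrow> ('x \<Rightarrow> 'x) \<Rightarrow> 'x set set \<Rightarrow>
     'w measure \<Rightarrow> ('w \<Rightarrow> 'w) \<Rightarrow> ('w \<Rightarrow> 'x \<Rightarrow> int) \<Rightarrow> bool" where
  "irreducible_dwde M T \<beta> P \<eta> \<phi> \<longleftrightarrow>
     (AE \<omega> in P. \<forall>a\<in>lifted_partition \<beta>. \<forall>b\<in>lifted_partition \<beta>.
        communicates M T (env P \<eta> \<phi> \<omega>) a b)"

definition linked ::
    "'x measure \<Rightarrow> ('x \<Rightarrow> 'x) \<Rightarrow> 'x set set \<Rightarrow> real \<Rightarrow> (int \<Rightarrow> 'x \<Rightarrow> int) \<Rightarrow>
     ('x \<times> int) set \<Rightarrow> ('x \<times> int) set \<Rightarrow> bool" where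
  "linked M T \<beta> r f a b \<longleftrightarrow> b \<subseteq> skew_product T f ` a \<or>
     (\<exists>n\<ge>1. \<exists>c\<in>cylinders (space M \<times> UNIV) (skew_product T f) (lifted_partition \<beta>) n.
        emeasure (lifted_measure M) c \<ge> ennreal r \<and>
        emeasure (lifted_measure M)
          (cylinder_product (space M \<times> UNIV) (skew_product T f) [(a, 1), (c, n), (b, 1)]) > 0)"

definition linkage_property ::
    "'x measure \<Rightarrow> ('x \<Rightarrow> 'x) \<Rightarrow> 'x set set \<Rightarrow>
     'w measure \<Rightarrow> ('w \<Rightarrow> 'w) \<Rightarrow> ('w \<Rightarrow> 'x \<Rightarrow> int) \<Rightarrow> bool" where
  "linkage_property M T \<beta> P \<eta> \<phi> \<longleftrightarrow> irreducible_dwde M T \<beta> P \<eta> \<phi> \<and>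
     (\<exists>r::real. r > 0 \<and> (AE \<omega> in P. \<forall>a\<in>\<beta>. \<forall>b\<in>\<beta>. \<forall>i j. \<bar>i - j\<bar> = 1 \<longrightarrow>
        linked M T \<beta> r (env P \<eta> \<phi> \<omega>) (a \<times> {i}) (b \<times> {j})))"

definition uniformly_bounded_jumps :: "'x set \<Rightarrow> ('x \<Rightarrow> int) set \<Rightarrow> bool" where
  "uniformly_bounded_jumps X G \<longleftrightarrow> (\<exists>J. finite J \<and> (\<forall>g\<in>G. g ` X \<subseteq> J))"

definition transitive_dwde ::
    "'x measure \<Rightarrow> ('x \<Rightarrow> 'x) \<Rightarrow> 'w measure \<Rightarrow> ('w \<Rightarrow> 'w) \<Rightarrow> ('w \<Rightarrow> 'x \<Rightarrow> int) \<Rightarrow> bool" where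
  "transitive_dwde M T P \<eta> \<phi> \<longleftrightarrow>
     (AE \<omega> in P. \<forall>i j. measure M {x \<in> space M. \<exists>n\<ge>1. walk T (env P \<eta> \<phi> \<omega>) i n x = j} = 1)"

section \<open>Symmetry at single transition functions\<close>

lemma neg_on_neg_on:
  assumes "g \<in> extensional X" shows "neg_on X (neg_on X g) = g"
  using assms by (auto simp: neg_on_def fun_eq_iff restrict_def extensional_def)

context dwde
begin

lemma transition_functions_eqI:
  assumes "f \<in> G" "g \<in> G" "\<And>a x. a \<in> \<beta> \<Longrightarrow> x \<in> a \<Longrightarrow> f x = g x"
  shows "f = g"
proof (rule extensionalityI[of _ "space M"])
  show "f \<in> extensional (space M)" "g \<in> extensional (space M)"
    using assms(1,2) transition_functions by (auto simp: transition_functions_def)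
  show "f x = g x" if "x \<in> space M" for x
  proof -
    have "x \<in> \<Union>\<beta>"
      using that markov_partition unfolding markov_partition_def partition_on_def by metis
    then show ?thesis using assms(3) by blast
  qed
qed

lemma finite_agreement:
  assumes "infinite \<beta>" "f \<in> G" "g \<in> G" "f \<noteq> g"
  shows "finite {n. \<forall>j\<in>{1..n}. \<forall>x\<in>\<alpha> j. f x = g x}"
proof -
  obtain a x where ax: "a \<in> \<beta>" "x \<in> a" "f x \<noteq> g x"
    using transition_functions_eqI assms by blast
  then obtain k where k: "k \<ge> 1" "\<alpha> k = a"
    using enumeration[OF assms(1)] by (auto simp: bij_betw_def image_iff)
  have "n < k" if "\<forall>j\<in>{1..n}. \<forall>x\<in>\<alpha> j. f x = g x" for n
    using that k ax by (force simp: not_less[symmetric])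
  then have "{n. \<forall>j\<in>{1..n}. \<forall>x\<in>\<alpha> j. f x = g x} \<subseteq> {..<k}" by blast
  then show ?thesis using finite_subset by blast
qed

lemma transition_metric:
  assumes inf: "infinite \<beta>"
  shows "Metric_space G (transition_dist \<alpha>)"
proof -
  let ?A = "\<lambda>f g. {n. \<forall>j\<in>{1..n}. \<forall>x\<in>\<alpha> j. f x = g x}"
  have ultra: "transition_dist \<alpha> f h \<le> max (transition_dist \<alpha> f g) (transition_dist \<alpha> g h)"
    if "f \<in> G" "g \<in> G" "h \<in> G" for f g h
  proof (cases "f = h \<or> f = g \<or> g = h")
    case True
    moreover have "0 \<le> transition_dist \<alpha> f' g'" for f' g' by (simp add: transition_dist_def)
    moreover have "transition_dist \<alpha> f' f' = 0" for f' by (simp add: transition_dist_def)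
    ultimately show ?thesis by (metis le_max_iff_disj order_refl)
  next
    case False
    have fin: "finite (?A f g)" "finite (?A g h)" "finite (?A f h)"
      using finite_agreement[OF inf] that False by auto
    have ne: "0 \<in> ?A f g" "0 \<in> ?A g h" by auto
    have M: "Max (?A f g) \<in> ?A f g" "Max (?A g h) \<in> ?A g h"
      using Max_in fin ne by blast+
    have "f x = h x" if "j \<in> {1..min (Max (?A f g)) (Max (?A g h))}" "x \<in> \<alpha> j" for j x
    proof -
      have "j \<in> {1..Max (?A f g)}" "j \<in> {1..Max (?A g h)}" using that(1) by simp_all
      then have "f x = g x" "g x = h x" using M that(2) by blast+
      then show ?thesis by (rule trans)
    qed
    then have "min (Max (?A f g)) (Max (?A g h)) \<in> ?A f h" by blast
    then have "min (Max (?A f g)) (Max (?A g h)) \<le> Max (?A f h)"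
      using fin(3) Max_ge by blast
    then have "(1/2::real) ^ Max (?A f h) \<le> (1/2) ^ min (Max (?A f g)) (Max (?A g h))"
      by (intro power_decreasing) auto
    also have "\<dots> \<le> max ((1/2) ^ Max (?A f g)) ((1/2) ^ Max (?A g h))"
      by (auto simp: min_def)
    finally show ?thesis using False by (simp add: transition_dist_def)
  qed
  have nn: "0 \<le> transition_dist \<alpha> f g" for f g by (simp add: transition_dist_def)
  show ?thesis
  proof
    show "0 \<le> transition_dist \<alpha> x y" for x y by (rule nn)
    show "transition_dist \<alpha> x y = transition_dist \<alpha> y x" for x y
    proof -
      have "?A x y = ?A y x" by (intro Collect_cong ball_cong refl) (rule eq_commute)
      moreover have "(x = y) = (y = x)" by (rule eq_commute)
      ultimately show ?thesis unfolding transition_dist_def by presburger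
    qed
    show "(transition_dist \<alpha> x y = 0) = (x = y)" for x y
      by (simp add: transition_dist_def)
    show "transition_dist \<alpha> x z \<le> transition_dist \<alpha> x y + transition_dist \<alpha> y z"
      if "x \<in> G" "y \<in> G" "z \<in> G" for x y z
      using ultra[OF that] nn[of x y] nn[of y z] by linarith
  qed
qed

lemma space_transition_borel: "space (transition_borel \<beta> \<alpha> G) = G"
  by (simp add: transition_borel_def space_measure_of_conv)

lemma singleton_transition_borel:
  assumes "g \<in> G" shows "{g} \<in> sets (transition_borel \<beta> \<alpha> G)"
proof -
  let ?t = "transition_topology \<beta> \<alpha> G"
  have top: "topspace ?t = G"
    using Metric_space.topspace_mtopology[OF transition_metric]
    by (auto simp: transition_topology_def)
  have "openin ?t (G - {g})"
  proof (cases "finite \<beta>")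
    case True then show ?thesis by (simp add: transition_topology_def)
  next
    case False
    interpret Metric_space G "transition_dist \<alpha>" by (rule transition_metric[OF False])
    have "closedin mtopology {g}"
      using assms by (metis Hausdorff_space_mtopology Hausdorff_imp_t1_space t1_space_closedin_singleton
        topspace_mtopology)
    then show ?thesis using False by (simp add: transition_topology_def closedin_def)
  qed
  moreover have sub: "{U. openin ?t U} \<subseteq> Pow G" using openin_subset top by fastforce
  ultimately have "G - {g} \<in> sets (transition_borel \<beta> \<alpha> G)"
    by (simp add: transition_borel_def)
  then have "space (transition_borel \<beta> \<alpha> G) - (G - {g}) \<in> sets (transition_borel \<beta> \<alpha> G)"
    by (rule sets.compl_sets)
  then show ?thesis using assms by (simp add: space_transition_borel double_diff)
qed

lemma symmetric_env_imp_pointwise: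
  assumes "symmetric_env (space M) \<beta> \<alpha> G P \<eta> \<phi>" "g \<in> G"
  shows "measure P {\<omega> \<in> space P. env P \<eta> \<phi> \<omega> i = g} =
         measure P {\<omega> \<in> space P. env P \<eta> \<phi> \<omega> i = neg_on (space M) g}"
  using assms singleton_transition_borel[of g] unfolding symmetric_env_def by fastforce

lemma measurable_env_at: "(\<lambda>\<omega>. env P \<eta> \<phi> \<omega> i) \<in> measurable P (transition_borel \<beta> \<alpha> G)"
proof -
  have pow: "h ^^ n \<in> measurable P P" if "h \<in> measurable P P" for h :: "'w \<Rightarrow> 'w" and n
  proof (induction n)
    case 0 then show ?case by (simp add: id_def)
  next
    case (Suc n) then show ?case using that by (auto intro: measurable_comp)
  qed
  have "int_iterate (space P) \<eta> i \<in> measurable P P"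
    using invertible pow by (auto simp: int_iterate_def invertible_transformation_def)
  from measurable_compose[OF this measurable_env] show ?thesis by (simp add: env_def)
qed

lemma symmetric_env_iff_pointwise:
  assumes cG: "countable G"
  shows "symmetric_env (space M) \<beta> \<alpha> G P \<eta> \<phi> \<longleftrightarrow>
    (\<forall>i. \<forall>g\<in>G. measure P {\<omega> \<in> space P. env P \<eta> \<phi> \<omega> i = g} =
                measure P {\<omega> \<in> space P. env P \<eta> \<phi> \<omega> i = neg_on (space M) g})" (is "_ \<longleftrightarrow> ?R")
proof
  assume "symmetric_env (space M) \<beta> \<alpha> G P \<eta> \<phi>"
  then show ?R using symmetric_env_imp_pointwise by blast
next
  assume R: ?R
  show "symmetric_env (space M) \<beta> \<alpha> G P \<eta> \<phi>"
    unfolding symmetric_env_def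
  proof (intro allI ballI)
    fix i A assume "A \<in> sets (transition_borel \<beta> \<alpha> G)"
    then have AG: "A \<subseteq> G" using sets.sets_into_space space_transition_borel by blast
    then have cA: "countable A" using cG countable_subset by blast
    let ?f = "\<lambda>\<omega>. env P \<eta> \<phi> \<omega> i" and ?n = "neg_on (space M)"
    have fG: "?f \<omega> \<in> G" if "\<omega> \<in> space P" for \<omega>
      using measurable_space[OF measurable_env_at that] by (simp add: space_transition_borel)
    have ms: "{\<omega> \<in> space P. ?f \<omega> = g} \<in> sets P" for g
    proof (cases "g \<in> G")
      case True
      have "?f -` {g} \<inter> space P \<in> sets P"
        by (rule measurable_sets[OF measurable_env_at singleton_transition_borel[OF True]])
      moreover have "?f -` {g} \<inter> space P = {\<omega> \<in> space P. ?f \<omega> = g}" by auto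
      ultimately show ?thesis by simp
    next
      case False
      then have "{\<omega> \<in> space P. ?f \<omega> = g} = {}" using fG by auto
      then show ?thesis by (simp only: sets.empty_sets)
    qed
    have inj: "inj_on ?n A"
    proof (rule inj_on_inverseI)
      fix g assume "g \<in> A"
      then have "g \<in> extensional (space M)"
        using AG transition_functions by (auto simp: transition_functions_def)
      then show "?n (?n g) = g" by (rule neg_on_neg_on)
    qed
    have "emeasure P {\<omega> \<in> space P. ?f \<omega> \<in> A} = emeasure P (\<Union>g\<in>A. {\<omega> \<in> space P. ?f \<omega> = g})"
      by (rule arg_cong[where f = "emeasure P"]) auto
    also have "\<dots> = (\<integral>\<^sup>+g. emeasure P {\<omega> \<in> space P. ?f \<omega> = g} \<partial>count_space A)"
      using ms cA by (intro emeasure_UN_countable) (auto simp: disjoint_family_on_def)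
    also have "\<dots> = (\<integral>\<^sup>+g. emeasure P {\<omega> \<in> space P. ?f \<omega> = ?n g} \<partial>count_space A)"
      using R AG by (intro nn_integral_cong) (auto simp: env.emeasure_eq_measure)
    also have "\<dots> = emeasure P (\<Union>g\<in>A. {\<omega> \<in> space P. ?f \<omega> = ?n g})"
      using ms cA inj
      by (intro emeasure_UN_countable[symmetric]) (auto simp: disjoint_family_on_def inj_on_def)
    also have "\<dots> = emeasure P {\<omega> \<in> space P. ?f \<omega> \<in> ?n ` A}"
      by (rule arg_cong[where f = "emeasure P"]) auto
    finally show "measure P {\<omega> \<in> space P. ?f \<omega> \<in> A} = measure P {\<omega> \<in> space P. ?f \<omega> \<in> ?n ` A}"
      by (simp add: measure_def)
  qed
qed

end

end

theory Submission
  imports Defs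
begin

text \<open>Fix an environment for which the skew product is irreducible. Since images of partition elements
  have measure bounded below, finitely many elements \<open>b\<close> suffice so that every \<open>T a\<close> contains one of
  them; together with distortion this turns positivity of hitting probabilities into the uniform
  statement that a walk which returns infinitely often to a set of sites from which a target is hit
  with uniformly positive probability hits that target almost surely. In particular a walk that is
  bounded above is unbounded below, and a walk unbounded in both directions hits every site, because
  it visits a window of the size of the jumps infinitely often.

  The set of environments in which some walk is bounded above with positive probability is invariant.
  If it had full measure, then by ergodicity there would be infinitely many windows to the right from
  which, with uniformly positive probability, the walk is bounded above and hence reaches any given
  level on the left; so almost every walk would be unbounded below. By independence and symmetry the
  reflected environment \<open>(-f\<^sub>-\<^sub>i)\<close> has the same law, so almost every walk would be unbounded above
  as well, a contradiction.\<close>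

section \<open>Cylinders and distortion\<close>

lemma walk_0: "walk T f i 0 x = i"
  by (simp add: walk_def)

lemma fst_skew_product_iter: "fst ((skew_product T f ^^ n) (x, i)) = (T ^^ n) x"
  by (induction n) (auto simp: skew_product_def case_prod_beta)

lemma skew_product_iter: "(skew_product T f ^^ n) (x, i) = ((T ^^ n) x, walk T f i n x)"
  by (rule prod_eqI) (simp_all add: walk_def fst_skew_product_iter)

lemma walk_Suc: "walk T f i (Suc n) x = walk T f i n x + f (walk T f i n x) ((T ^^ n) x)"
  by (simp add: walk_def[of _ _ _ "Suc n"] skew_product_iter) (simp add: skew_product_def)

text \<open>The cocycle identity: after time \<open>n\<close> the walk starts afresh from its
  current site, driven by the orbit of \<open>(T ^^ n) x\<close>. It takes the place of the Markov
  property.\<close>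

lemma walk_add: "walk T f i (k + n) x = walk T f (walk T f i n x) k ((T ^^ n) x)"
  by (simp add: walk_def[of _ _ _ "k + n"] funpow_add skew_product_iter)

context markov_map
begin

abbreviation cyl :: "nat \<Rightarrow> 'x set set" where
  "cyl n \<equiv> cylinders (space M) T \<beta> n"

lemma T_measurable: "T \<in> measurable M M"
  using nonsingular by (simp add: nonsingular_def)

lemma iter_measurable [measurable]: "T ^^ n \<in> measurable M M"
proof (induction n)
  case 0 then show ?case by (simp add: id_def)
next
  case (Suc n) then show ?case unfolding funpow.simps(2) by (rule measurable_comp[OF _ T_measurable])
qed

lemma iter_space: "x \<in> space M \<Longrightarrow> (T ^^ n) x \<in> space M"
  using measurable_space[OF iter_measurable] .

lemma countable_partition: "countable \<beta>"
  and partition_sets: "b \<in> \<beta> \<Longrightarrow> b \<in> sets M"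
  and partition: "partition_on (space M) \<beta>"
  using markov_partition by (auto simp: markov_partition_def)

lemma ex_partition: "x \<in> space M \<Longrightarrow> \<exists>b\<in>\<beta>. x \<in> b"
  using partition by (auto simp: partition_on_def)

lemma partition_unique: "a \<in> \<beta> \<Longrightarrow> b \<in> \<beta> \<Longrightarrow> x \<in> a \<Longrightarrow> x \<in> b \<Longrightarrow> a = b"
  using partition unfolding partition_on_def disjoint_def by blast

lemma image_partition:
  assumes "a \<in> \<beta>"
  shows "T ` a \<in> sets M" and "b \<in> \<beta> \<Longrightarrow> x \<in> b \<Longrightarrow> x \<in> T ` a \<Longrightarrow> b \<subseteq> T ` a"
proof -
  obtain S where S: "S \<subseteq> \<beta>" "T ` a = \<Union>S"
    using markov_partition assms by (auto simp: markov_partition_def)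
  then show "T ` a \<in> sets M"
    using countable_partition partition_sets
    by (metis countable_subset sets.countable_Union subset_iff)
  show "b \<subseteq> T ` a" if "b \<in> \<beta>" "x \<in> b" "x \<in> T ` a"
    using S that partition_unique by blast
qed

section \<open>Cylinders as classes of equal itineraries\<close>

lemma cylinders_sets: "c \<in> cyl n \<Longrightarrow> c \<in> sets M"
proof -
  assume "c \<in> cyl n"
  then obtain a where a: "c = {x \<in> space M. \<forall>j<n. (T ^^ j) x \<in> a j}" "\<forall>j<n. a j \<in> \<beta>"
    by (auto simp: cylinders_def)
  have "{x \<in> space M. \<forall>j\<in>{..<n}. (T ^^ j) x \<in> a j} \<in> sets M"
    using a(2) partition_sets by (intro sets.sets_Collect_finite_All) auto
  moreover have "{x \<in> space M. \<forall>j\<in>{..<n}. (T ^^ j) x \<in> a j} = c" unfolding a(1) by blast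
  ultimately show ?thesis by simp
qed

lemma cylinders_SucE:
  assumes "c \<in> cyl (Suc n)"
  obtains d b where "d \<in> cyl n" "b \<in> \<beta>" "c = d \<inter> {x \<in> space M. (T ^^ n) x \<in> b}"
proof -
  obtain a where a: "c = {x \<in> space M. \<forall>j<Suc n. (T ^^ j) x \<in> a j}" "\<forall>j<Suc n. a j \<in> \<beta>"
    using assms by (auto simp: cylinders_def)
  show ?thesis
  proof (rule that)
    show "{x \<in> space M. \<forall>j<n. (T ^^ j) x \<in> a j} \<in> cyl n"
      using a(2) by (auto simp: cylinders_def)
    show "a n \<in> \<beta>" using a(2) by simp
    show "c = {x \<in> space M. \<forall>j<n. (T ^^ j) x \<in> a j} \<inter> {x \<in> space M. (T ^^ n) x \<in> a n}"
      unfolding a(1) by (auto simp: less_Suc_eq)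
  qed
qed

lemma countable_cylinders: "countable (cyl n)"
proof (induction n)
  case 0 then show ?case by (simp add: cylinders_def)
next
  case (Suc n)
  have "cyl (Suc n) \<subseteq> (\<lambda>(d, b). d \<inter> {x \<in> space M. (T ^^ n) x \<in> b}) ` (cyl n \<times> \<beta>)"
    by (auto elim!: cylinders_SucE)
  then show ?case
    by (rule countable_subset) (use Suc countable_partition in auto)
qed

lemma ex_cylinder: assumes "x \<in> space M" shows "\<exists>c\<in>cyl n. x \<in> c"
proof -
  obtain a where "\<And>j. a j \<in> \<beta> \<and> (T ^^ j) x \<in> a j"
    using ex_partition[OF iter_space[OF assms]] by metis
  then show ?thesis
    using assms unfolding cylinders_def by (intro bexI[of _ "{x \<in> space M. \<forall>j<n. (T ^^ j) x \<in> a j}"]) auto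
qed

definition same_cylinder :: "nat \<Rightarrow> 'x \<Rightarrow> 'x \<Rightarrow> bool" where
  "same_cylinder n x y \<longleftrightarrow> (\<forall>j<n. \<forall>b\<in>\<beta>. (T ^^ j) x \<in> b \<longleftrightarrow> (T ^^ j) y \<in> b)"

lemma same_cylinder_cyl: "c \<in> cyl n \<Longrightarrow> x \<in> c \<Longrightarrow> y \<in> c \<Longrightarrow> same_cylinder n x y"
  using partition_unique unfolding cylinders_def same_cylinder_def by blast

text \<open>A cylinder of rank \<open>n\<close> is a full class of \<open>same_cylinder n\<close>.
  By symmetry two cylinders of the same rank that meet are equal.\<close>

lemma cylinders_disjoint: "c \<in> cyl n \<Longrightarrow> d \<in> cyl n \<Longrightarrow> x \<in> c \<Longrightarrow> x \<in> d \<Longrightarrow> c \<subseteq> d"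
  using same_cylinder_cyl unfolding cylinders_def same_cylinder_def by blast

lemma cylinders_subset_partition:
  assumes "c \<in> cyl n" "n \<ge> 1" "x \<in> c" "x \<in> b" "b \<in> \<beta>" shows "c \<subseteq> b"
  using same_cylinder_cyl[OF assms(1,3)] assms(2,4,5) unfolding same_cylinder_def
  by (force dest: spec[of _ 0])

text \<open>Events decided by the first \<open>n\<close> letters of the itinerary, that is, unions
  of cylinders of rank \<open>n\<close>. They play the role of the events known at time
  \<open>n\<close>.\<close>

definition determined :: "nat \<Rightarrow> 'x set \<Rightarrow> bool" where
  "determined n U \<longleftrightarrow> U \<subseteq> space M \<and> (\<forall>x\<in>U. \<forall>y\<in>space M. same_cylinder n x y \<longrightarrow> y \<in> U)"

lemma determined_UN_cyl:
  assumes "determined n U" shows "U = (\<Union>c\<in>{c\<in>cyl n. c \<subseteq> U}. c)"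
proof -
  have "\<exists>c\<in>cyl n. x \<in> c \<and> c \<subseteq> U" if x: "x \<in> U" for x
  proof -
    obtain c where c: "c \<in> cyl n" "x \<in> c"
      using ex_cylinder assms x unfolding determined_def by blast
    have "y \<in> U" if "y \<in> c" for y
      using same_cylinder_cyl[OF c that] assms x that sets.sets_into_space[OF cylinders_sets[OF c(1)]]
      unfolding determined_def by blast
    then show ?thesis using c by blast
  qed
  then show ?thesis by blast
qed

lemma determined_sets: assumes "determined n U" shows "U \<in> sets M"
proof -
  have "(\<Union>c\<in>{c\<in>cyl n. c \<subseteq> U}. c) \<in> sets M"
    using countable_cylinders cylinders_sets by (intro sets.countable_UN') (auto intro: countable_subset)
  then show ?thesis using determined_UN_cyl[OF assms] by simp
qed

text \<open>Countable additivity over the cylinders contained in \<open>U\<close>. Empty cylinders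
  are exempt from the hypothesis because the description of \<open>T ^^ n\<close>-images holds only
  for nonempty ones.\<close>

lemma determined_emeasure_le:
  assumes U: "determined n U" and H: "H \<in> sets M"
    and le: "\<And>c. c \<in> cyl n \<Longrightarrow> c \<subseteq> U \<Longrightarrow> c \<noteq> {} \<Longrightarrow> emeasure M c \<le> K * emeasure M (c \<inter> H)"
  shows "emeasure M U \<le> K * emeasure M (U \<inter> H)"
proof -
  let ?I = "{c\<in>cyl n. c \<subseteq> U}"
  have cI: "countable ?I" using countable_cylinders by (auto intro: countable_subset)
  have disj: "disjoint_family_on (\<lambda>c. c \<inter> Y) ?I" for Y
    using cylinders_disjoint unfolding disjoint_family_on_def by blast
  have UN: "(\<Union>c\<in>?I. c \<inter> Y) = U \<inter> Y" for Y
  proof -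
    have "(\<Union>c\<in>?I. c \<inter> Y) = (\<Union>c\<in>?I. c) \<inter> Y" by blast
    then show ?thesis by (simp only: determined_UN_cyl[OF U, symmetric])
  qed
  have "U \<subseteq> space M" using U by (simp add: determined_def)
  then have "emeasure M U = emeasure M (\<Union>c\<in>?I. c \<inter> space M)"
    by (simp only: UN Int_absorb2)
  also have "\<dots> = (\<integral>\<^sup>+c. emeasure M (c \<inter> space M) \<partial>count_space ?I)"
    using cI disj cylinders_sets by (intro emeasure_UN_countable) auto
  also have "\<dots> \<le> (\<integral>\<^sup>+c. K * emeasure M (c \<inter> H) \<partial>count_space ?I)"
  proof (intro nn_integral_mono)
    fix c assume "c \<in> space (count_space ?I)"
    then have c: "c \<in> cyl n" "c \<subseteq> U" by auto
    then have "c \<inter> space M = c" using \<open>U \<subseteq> space M\<close> by blast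
    then show "emeasure M (c \<inter> space M) \<le> K * emeasure M (c \<inter> H)"
      using le[OF c] by (cases "c = {}") simp_all
  qed
  also have "\<dots> = K * (\<integral>\<^sup>+c. emeasure M (c \<inter> H) \<partial>count_space ?I)"
    by (intro nn_integral_cmult) auto
  also have "(\<integral>\<^sup>+c. emeasure M (c \<inter> H) \<partial>count_space ?I) = emeasure M (\<Union>c\<in>?I. c \<inter> H)"
    using cI disj cylinders_sets H by (intro emeasure_UN_countable[symmetric]) auto
  also note UN
  finally show ?thesis .
qed

text \<open>The image is the last letter of the cylinder. Induction on the rank: \<open>T\<close> of
  the previous letter is a union of partition elements, so it contains the next letter as soon as it
  meets it.\<close>

lemma image_cylinder:
  assumes "c \<in> cyl (Suc n)" "c \<noteq> {}"
  shows "\<exists>b\<in>\<beta>. (T ^^ n) ` c = b"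
  using assms
proof (induction n arbitrary: c)
  case 0
  obtain d b where "d \<in> cyl 0" "b \<in> \<beta>" "c = d \<inter> {x \<in> space M. (T ^^ 0) x \<in> b}"
    using cylinders_SucE[OF 0(1)] .
  moreover have "b \<subseteq> space M" if "b \<in> \<beta>" for b using partition_sets sets.sets_into_space that by blast
  ultimately have "c = b" by (auto simp: cylinders_def)
  then show ?case using \<open>b \<in> \<beta>\<close> by simp
next
  case (Suc n)
  obtain d b where d: "d \<in> cyl (Suc n)" "b \<in> \<beta>" "c = d \<inter> {x \<in> space M. (T ^^ Suc n) x \<in> b}"
    using cylinders_SucE[OF Suc.prems(1)] .
  obtain a where a: "a \<in> \<beta>" "(T ^^ n) ` d = a" using Suc.IH[OF d(1)] Suc.prems(2) d(3) by blast
  have im: "(T ^^ Suc n) ` d = T ` a" using a(2) by (auto simp: image_comp[symmetric])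
  obtain x where x: "x \<in> c" using Suc.prems(2) by blast
  have "b \<subseteq> T ` a"
  proof (rule image_partition(2)[OF a(1) d(2)])
    show "(T ^^ Suc n) x \<in> b" using x d(3) by auto
    show "(T ^^ Suc n) x \<in> T ` a" using x d(3) im by blast
  qed
  then have "b \<subseteq> (T ^^ Suc n) ` d" using im by simp
  moreover have "d \<subseteq> space M" using d(1) cylinders_sets sets.sets_into_space by blast
  ultimately have "(T ^^ Suc n) ` c = b" unfolding d(3) by blast
  then show ?case using d(2) by blast
qed

text \<open>One more step of \<open>T\<close> leaves an image of a single partition element. Hence
  bounds that hold on all \<open>T\<close>-images of elements of \<beta> hold on the images of
  cylinders of every rank.\<close>

lemma image_cylinder':
  assumes "c \<in> cyl n" "n \<ge> 1" "c \<noteq> {}"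
  shows "\<exists>b\<in>\<beta>. (T ^^ n) ` c = T ` b"
proof -
  obtain k where k: "n = Suc k" using assms(2) by (cases n) auto
  obtain b where "b \<in> \<beta>" "(T ^^ k) ` c = b" using image_cylinder assms k by blast
  then show ?thesis unfolding k by (intro bexI[of _ b]) (auto simp: image_image)
qed

section \<open>Nonsingular iterates and bounded distortion\<close>

lemma iter_null:
  assumes "A \<in> sets M" "emeasure M A = 0"
  shows "emeasure M ((T ^^ n) -` A \<inter> space M) = 0"
proof (induction n)
  case 0
  then show ?case using assms sets.sets_into_space by (simp add: Int_absorb2)
next
  case (Suc n)
  let ?B = "(T ^^ n) -` A \<inter> space M"
  have "?B \<in> sets M" using assms by measurable
  then have "emeasure M (T -` ?B \<inter> space M) = 0"
    using nonsingular Suc unfolding nonsingular_def by blast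
  moreover have "T -` ?B \<inter> space M = (T ^^ Suc n) -` A \<inter> space M"
    using iter_space[of _ 1] by (auto simp: funpow_swap1)
  ultimately show ?case by (simp only:)
qed

definition distortion_const :: real where
  "distortion_const = (SOME D. D \<ge> 1 \<and> (\<forall>n\<ge>1. \<forall>a\<in>cyl n.
        AE x in M. AE y in M. x \<in> (T ^^ n) ` a \<longrightarrow> y \<in> (T ^^ n) ` a \<longrightarrow>
          cylinder_deriv M T n a x / cylinder_deriv M T n a y \<le> ennreal D))"

lemma distortion_const: "distortion_const \<ge> 1"
  "n \<ge> 1 \<Longrightarrow> c \<in> cyl n \<Longrightarrow> AE x in M. AE y in M. x \<in> (T ^^ n) ` c \<longrightarrow> y \<in> (T ^^ n) ` c \<longrightarrow>
          cylinder_deriv M T n c x / cylinder_deriv M T n c y \<le> ennreal distortion_const"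
  using someI_ex[OF strong_distortion[unfolded strong_distortion_def]]
  unfolding distortion_const_def[symmetric] by auto

text \<open>The density of the push-forward of the measure on \<open>c\<close> varies at most by the
  factor \<open>distortion_const\<close> over the image. So, up to this factor,
  \<open>T ^^ n\<close> carries a subset of the image back to at least its share of
  \<open>c\<close>.\<close>

lemma distortion:
  assumes c: "c \<in> cyl n" "n \<ge> 1" "c \<noteq> {}" and E: "E \<in> sets M"
  shows "emeasure M c * emeasure M (E \<inter> (T ^^ n) ` c) \<le>
         ennreal distortion_const * emeasure M (c \<inter> ((T ^^ n) -` E \<inter> space M))"
proof -
  let ?D = "ennreal distortion_const"
  define I where "I = (T ^^ n) ` c"
  define v where "v = cylinder_deriv M T n c"
  define N where "N = distr (density M (indicator c)) M (T ^^ n)"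
  have cM: "c \<in> sets M" using c cylinders_sets by blast
  have I: "I \<in> sets M" using image_cylinder'[OF c] image_partition(1) by (auto simp: I_def)
  have NB: "emeasure N B = emeasure M (c \<inter> ((T ^^ n) -` B \<inter> space M))" if "B \<in> sets M" for B
  proof -
    let ?B = "(T ^^ n) -` B \<inter> space M"
    have B: "?B \<in> sets M" using that by measurable
    have "emeasure N B = emeasure (density M (indicator c)) ?B"
      unfolding N_def using that by (subst emeasure_distr) simp_all
    also have "\<dots> = (\<integral>\<^sup>+x. indicator c x * indicator ?B x \<partial>M)"
      using B cM by (intro emeasure_density) simp_all
    also have "\<dots> = (\<integral>\<^sup>+x. indicator (c \<inter> ?B) x \<partial>M)"
      by (intro nn_integral_cong) (simp add: indicator_def)
    also have "\<dots> = emeasure M (c \<inter> ?B)"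
      using B cM by (intro nn_integral_indicator) simp
    finally show ?thesis .
  qed
  \<comment> \<open>Without absolute continuity the Radon-Nikodym derivative would not recover
    \<open>N\<close>; null sets are pulled back to null sets by \<open>iter_null\<close>.\<close>
  have abs: "absolutely_continuous M N"
    unfolding absolutely_continuous_def
  proof
    fix A assume A: "A \<in> null_sets M"
    then have "emeasure N A \<le> emeasure M ((T ^^ n) -` A \<inter> space M)"
      by (subst NB) (auto intro!: emeasure_mono)
    also have "\<dots> = 0" using iter_null A by auto
    finally show "A \<in> null_sets N" using A by (intro null_setsI) (auto simp: N_def)
  qed
  have dens: "density M v = N"
    unfolding v_def cylinder_deriv_def N_def[symmetric]
    by (rule density_RN_deriv[OF abs]) (simp add: N_def)
  have vm [measurable]: "v \<in> borel_measurable M"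
    unfolding v_def cylinder_deriv_def by simp
  have vB: "(\<integral>\<^sup>+y. v y * indicator B y \<partial>M) = emeasure N B" if "B \<in> sets M" for B
    using that by (simp add: dens[symmetric] emeasure_density)
  have "AE x in M. AE y in M. x \<in> I \<longrightarrow> y \<in> I \<longrightarrow> v x \<le> ?D * v y"
    using distortion_const(2)[OF c(2,1)]
  proof (rule eventually_mono)
    fix x assume "AE y in M. x \<in> (T ^^ n) ` c \<longrightarrow> y \<in> (T ^^ n) ` c \<longrightarrow>
          cylinder_deriv M T n c x / cylinder_deriv M T n c y \<le> ?D"
    then show "AE y in M. x \<in> I \<longrightarrow> y \<in> I \<longrightarrow> v x \<le> ?D * v y"
    proof (rule eventually_mono, intro impI)
      fix y assume "x \<in> (T ^^ n) ` c \<longrightarrow> y \<in> (T ^^ n) ` c \<longrightarrow>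
            cylinder_deriv M T n c x / cylinder_deriv M T n c y \<le> ?D" "x \<in> I" "y \<in> I"
      then have le: "v x / v y \<le> ?D" by (simp add: I_def v_def)
      have D0: "?D \<noteq> 0" using distortion_const(1) by simp
      show "v x \<le> ?D * v y"
      \<comment> \<open>In \<open>ennreal\<close> a positive number divided by 0 is infinite, so
        \<open>v y = 0\<close> forces \<open>v x = 0\<close>; if \<open>v y\<close> is infinite, so
        is the right-hand side, because \<open>?D\<close> is not 0.\<close>
      proof (cases "v y = 0 \<or> v y = top")
        case True
        then show ?thesis using le D0
          by (auto simp: ennreal_mult_top ennreal_divide_zero top_unique split: if_splits)
      next
        case False
        then have "v x = v x / v y * v y"
          by (simp add: ennreal_divide_times ennreal_times_divide[symmetric] less_top[symmetric] ennreal_divide_self)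
        also have "\<dots> \<le> ?D * v y" by (intro mult_right_mono le) auto
        finally show ?thesis .
      qed
    qed
  qed
  \<comment> \<open>The pointwise comparison is integrated over \<open>y\<close> in
    \<open>E \<inter> I\<close> with \<open>x\<close> fixed, and afterwards over \<open>x\<close> in
    \<open>I\<close>.\<close>
  then have "AE x in M. v x * indicator I x * emeasure M (E \<inter> I) \<le> ?D * emeasure N (E \<inter> I) * indicator I x"
  proof eventually_elim
    case (elim x)
    show ?case
    proof (cases "x \<in> I")
      case True
      have "v x * emeasure M (E \<inter> I) = (\<integral>\<^sup>+y. v x * indicator (E \<inter> I) y \<partial>M)"
        using E I by (simp add: nn_integral_cmult_indicator)
      also have "\<dots> \<le> (\<integral>\<^sup>+y. ?D * (v y * indicator (E \<inter> I) y) \<partial>M)"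
        using elim True by (intro nn_integral_mono_AE) (auto simp: indicator_def elim!: eventually_mono)
      also have "\<dots> = ?D * emeasure N (E \<inter> I)"
        using E I vB[of "E \<inter> I"] by (simp add: nn_integral_cmult)
      finally show ?thesis using True by simp
    qed simp
  qed
  then have "(\<integral>\<^sup>+x. v x * indicator I x * emeasure M (E \<inter> I) \<partial>M) \<le>
             (\<integral>\<^sup>+x. ?D * emeasure N (E \<inter> I) * indicator I x \<partial>M)"
    by (rule nn_integral_mono_AE)
  then have "emeasure N I * emeasure M (E \<inter> I) \<le> ?D * emeasure N (E \<inter> I) * emeasure M I"
    using I by (simp add: nn_integral_multc vB nn_integral_cmult_indicator)
  also have "\<dots> \<le> ?D * emeasure N (E \<inter> I) * 1"
    by (intro mult_left_mono) (auto simp: emeasure_le_1)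
  also have "\<dots> \<le> ?D * emeasure N E"
    using E I by (auto intro!: mult_left_mono emeasure_mono simp: N_def)
  finally have "emeasure N I * emeasure M (E \<inter> I) \<le> ?D * emeasure N E" .
  \<comment> \<open>Since \<open>I\<close> is the image of \<open>c\<close>, this identifies
    \<open>emeasure N I\<close> with \<open>emeasure M c\<close>.\<close>
  moreover have "c \<inter> ((T ^^ n) -` I \<inter> space M) = c"
    using sets.sets_into_space[OF cM] by (auto simp: I_def)
  ultimately show ?thesis using NB E I by (simp add: I_def)
qed

text \<open>Finitely many partition elements cover all but less than the big image bound \<delta>.
  Each image \<open>T a\<close> has measure at least \<delta>, so it meets one of them and, being a
  union of partition elements, contains it.\<close>

lemma finite_net: "\<exists>B\<subseteq>\<beta>. finite B \<and> (\<forall>a\<in>\<beta>. \<exists>b\<in>B. b \<subseteq> T ` a)"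
proof -
  define \<delta> where "\<delta> = (INF a\<in>\<beta>. measure M (T ` a))"
  have \<delta>: "\<delta> > 0" using big_image by (simp add: big_image_def \<delta>_def)
  have le: "\<delta> \<le> measure M (T ` a)" if "a \<in> \<beta>" for a
    unfolding \<delta>_def using that by (intro cINF_lower bdd_belowI[of _ 0]) auto
  have ne: "\<beta> \<noteq> {}" using ex_partition not_empty by blast
  \<comment> \<open>For finite \<beta> this enumeration repeats elements, which is harmless because
    only unions are formed.\<close>
  let ?e = "from_nat_into \<beta>"
  let ?U = "\<lambda>n. \<Union>k<n. ?e k"
  have e: "?e k \<in> \<beta>" for k using ne by (rule from_nat_into)
  have "(\<lambda>n. prob (?U n)) \<longlonglongrightarrow> prob (\<Union>n. ?U n)"
  proof (rule finite_Lim_measure_incseq)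
    show "range ?U \<subseteq> events" using e partition_sets by auto
    show "incseq ?U" by (intro monoI UN_mono) auto
  qed
  moreover have "(\<Union>n. ?U n) = space M"
  proof -
    have "(\<Union>n. ?U n) = (\<Union>k. ?e k)" by auto
    also have "\<dots> = \<Union>\<beta>" using range_from_nat_into[OF ne countable_partition] by metis
    finally show ?thesis using partition by (simp add: partition_on_def)
  qed
  ultimately have "(\<lambda>n. prob (?U n)) \<longlonglongrightarrow> 1" by (simp add: prob_space)
  then have "eventually (\<lambda>n. prob (?U n) > 1 - \<delta>) sequentially"
    using \<delta> by (intro order_tendstoD) auto
  then obtain n where n: "prob (?U n) > 1 - \<delta>" by (auto simp: eventually_sequentially)
  have "\<exists>b\<in>?e ` {..<n}. b \<subseteq> T ` a" if a: "a \<in> \<beta>" for a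
  proof (rule ccontr)
    assume neg: "\<not> ?thesis"
    have "?e k \<inter> T ` a = {}" if "k < n" for k
      using image_partition(2)[OF a e] neg that by blast
    then have "?U n \<inter> T ` a = {}" by blast
    moreover have "?U n \<in> events" using e partition_sets by auto
    ultimately have "prob (?U n \<union> T ` a) = prob (?U n) + prob (T ` a)"
      using image_partition(1)[OF a] by (intro finite_measure_Union) auto
    then show False using le[OF a] n prob_le_1[of "?U n \<union> T ` a"] by linarith
  qed
  then show ?thesis using e by (intro exI[of _ "?e ` {..<n}"]) auto
qed

end

section \<open>Walks in a fixed environment\<close>

text \<open>Time 0 is excluded, as in the definition of transitivity, so that hitting the starting
  site means returning to it.\<close>

definition hit :: "'x measure \<Rightarrow> ('x \<Rightarrow> 'x) \<Rightarrow> (int \<Rightarrow> 'x \<Rightarrow> int) \<Rightarrow> int \<Rightarrow> int set \<Rightarrow> 'x set" where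
  "hit M T f i J = {x \<in> space M. \<exists>n\<ge>1. walk T f i n x \<in> J}"

definition bounded_above :: "'x measure \<Rightarrow> ('x \<Rightarrow> 'x) \<Rightarrow> (int \<Rightarrow> 'x \<Rightarrow> int) \<Rightarrow> int \<Rightarrow> 'x set" where
  "bounded_above M T f i = {x \<in> space M. \<exists>K. \<forall>n. walk T f i n x \<le> K}"

definition bounded_below :: "'x measure \<Rightarrow> ('x \<Rightarrow> 'x) \<Rightarrow> (int \<Rightarrow> 'x \<Rightarrow> int) \<Rightarrow> int \<Rightarrow> 'x set" where
  "bounded_below M T f i = {x \<in> space M. \<exists>K. \<forall>n. K \<le> walk T f i n x}"

definition (in markov_map) net :: "'x set set" where
  "net = (SOME B. B \<subseteq> \<beta> \<and> finite B \<and> (\<forall>a\<in>\<beta>. \<exists>b\<in>B. b \<subseteq> T ` a))"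

lemma (in markov_map) net:
  shows "net \<subseteq> \<beta>" "finite net" "a \<in> \<beta> \<Longrightarrow> \<exists>b\<in>net. b \<subseteq> T ` a"
  using someI_ex[OF finite_net] unfolding net_def[symmetric] by auto

text \<open>One fixed environment. What holds for almost every environment is assumed here outright,
  so that only the randomness of the starting point is left.\<close>

locale quenched_walk = markov_map M T \<beta>
  for M :: "'x measure" and T :: "'x \<Rightarrow> 'x" and \<beta> :: "'x set set" +
  fixes f :: "int \<Rightarrow> 'x \<Rightarrow> int" and L :: int
  assumes f_const: "b \<in> \<beta> \<Longrightarrow> f i constant_on b"
    and f_bounded: "x \<in> space M \<Longrightarrow> \<bar>f i x\<bar> \<le> L"
    and communicating: "u \<in> lifted_partition \<beta> \<Longrightarrow> v \<in> lifted_partition \<beta> \<Longrightarrow> communicates M T f u v"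
begin

text \<open>The first \<open>k\<close> steps read only the letters at times below \<open>k\<close>,
  and transition functions are constant on partition elements.\<close>

lemma walk_same_cylinder:
  assumes "x \<in> space M" "y \<in> space M" "same_cylinder n x y" "k \<le> n"
  shows "walk T f i k x = walk T f i k y"
  using assms(4)
proof (induction k)
  case 0 then show ?case by (simp add: walk_0)
next
  case (Suc k)
  obtain b where b: "b \<in> \<beta>" "(T ^^ k) x \<in> b" using ex_partition[OF iter_space[OF assms(1)]] by blast
  then have "(T ^^ k) y \<in> b" using assms(3) Suc.prems unfolding same_cylinder_def by auto
  then have "f j ((T ^^ k) x) = f j ((T ^^ k) y)" for j
    using f_const[OF b(1)] b(2) unfolding constant_on_def by metis
  then show ?case using Suc by (simp add: walk_Suc)
qed

lemma walk_measurable [measurable]: "walk T f i n \<in> measurable M (count_space UNIV)"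
proof -
  have "determined n (walk T f i n -` {p} \<inter> space M)" for p
    using walk_same_cylinder[of _ _ n n i] unfolding determined_def by fastforce
  then show ?thesis
    using determined_sets by (subst measurable_count_space_eq2_countable) auto
qed

lemma hit_sets [measurable]: "hit M T f i J \<in> sets M"
  unfolding hit_def by measurable

lemma bounded_sets [measurable]: "bounded_above M T f i \<in> sets M" "bounded_below M T f i \<in> sets M"
  unfolding bounded_above_def bounded_below_def by measurable

lemma hit_shift:
  assumes "x \<in> space M" "(T ^^ n) x \<in> hit M T f (walk T f i n x) J"
  shows "x \<in> hit M T f i J"
proof -
  obtain k where "k \<ge> 1" "walk T f (walk T f i n x) k ((T ^^ n) x) \<in> J"
    using assms(2) by (auto simp: hit_def)
  then have "k + n \<ge> 1" "walk T f i (k + n) x \<in> J" by (auto simp: walk_add)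
  then show ?thesis unfolding hit_def using assms(1) by blast
qed

text \<open>Given a cylinder of rank \<open>n\<close> that ends at a site of \<open>C\<close>, the
  chance of hitting \<open>J\<close> afterwards is at least \<epsilon> divided by the distortion
  constant: the cylinder is mapped onto some \<open>T b\<close>, where the hypothesis applies, and
  distortion pulls the estimate back.\<close>

lemma emeasure_le_hit:
  assumes \<epsilon>: "\<epsilon> > 0" "\<And>p a. p \<in> C \<Longrightarrow> a \<in> \<beta> \<Longrightarrow> \<epsilon> \<le> prob (T ` a \<inter> hit M T f p J)"
    and U: "determined n U" "n \<ge> 1" "\<And>x. x \<in> U \<Longrightarrow> walk T f i n x \<in> C"
  shows "emeasure M U \<le> ennreal (distortion_const / \<epsilon>) * emeasure M (U \<inter> hit M T f i J)"
proof (rule determined_emeasure_le[OF U(1) hit_sets])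
  fix c assume c: "c \<in> cyl n" "c \<subseteq> U" "c \<noteq> {}"
  then obtain x where x: "x \<in> c" by blast
  define p where "p = walk T f i n x"
  have csp: "c \<subseteq> space M" using cylinders_sets[OF c(1)] sets.sets_into_space by blast
  have wp: "walk T f i n y = p" if "y \<in> c" for y
    unfolding p_def using walk_same_cylinder[OF _ _ same_cylinder_cyl[OF c(1) that x] order_refl] csp that x
    by blast
  have pC: "p \<in> C" using U(3) x c(2) by (auto simp: p_def)
  obtain b where b: "b \<in> \<beta>" "(T ^^ n) ` c = T ` b" using image_cylinder'[OF c(1) U(2) c(3)] by blast
  let ?H = "hit M T f p J"
  have "ennreal \<epsilon> \<le> emeasure M (?H \<inter> (T ^^ n) ` c)"
    using \<epsilon>(2)[OF pC b(1)] by (simp add: b(2) emeasure_eq_measure Int_commute ennreal_leI)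
  then have "emeasure M c * ennreal \<epsilon> \<le> emeasure M c * emeasure M (?H \<inter> (T ^^ n) ` c)"
    by (rule mult_left_mono) simp
  also have "\<dots> \<le> ennreal distortion_const * emeasure M (c \<inter> ((T ^^ n) -` ?H \<inter> space M))"
    by (rule distortion[OF c(1) U(2) c(3) hit_sets])
  also have "c \<inter> ((T ^^ n) -` ?H \<inter> space M) \<subseteq> c \<inter> hit M T f i J"
    using hit_shift wp csp by blast
  then have "ennreal distortion_const * emeasure M (c \<inter> ((T ^^ n) -` ?H \<inter> space M)) \<le>
      ennreal distortion_const * emeasure M (c \<inter> hit M T f i J)"
    using cylinders_sets[OF c(1)] by (intro mult_left_mono emeasure_mono) auto
  finally have "prob c * \<epsilon> \<le> distortion_const * prob (c \<inter> hit M T f i J)"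
    using \<epsilon>(1) distortion_const(1) by (simp add: emeasure_eq_measure ennreal_mult[symmetric])
  then have "prob c \<le> distortion_const / \<epsilon> * prob (c \<inter> hit M T f i J)"
    using \<epsilon>(1) by (simp add: field_simps)
  then show "emeasure M c \<le> ennreal (distortion_const / \<epsilon>) * emeasure M (c \<inter> hit M T f i J)"
    using \<epsilon>(1) distortion_const(1) by (simp add: emeasure_eq_measure ennreal_mult[symmetric] ennreal_leI)
qed

text \<open>A conditional Borel-Cantelli lemma in which distortion replaces independence. It is
  applied to finite \<open>C\<close> with a single target and to an infinite union of windows with a
  half-line as target.\<close>

lemma AE_recurrent_hit:
  assumes \<epsilon>: "\<epsilon> > 0" "\<And>p a. p \<in> C \<Longrightarrow> a \<in> \<beta> \<Longrightarrow> \<epsilon> \<le> prob (T ` a \<inter> hit M T f p J)"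
  shows "AE x in M. (\<exists>\<^sub>\<infinity>n. walk T f i n x \<in> C) \<longrightarrow> x \<in> hit M T f i J"
proof -
  let ?K = "ennreal (distortion_const / \<epsilon>)" and ?H = "hit M T f i J"
  \<comment> \<open>\<open>N t\<close> decreases to the exceptional set, and \<open>N t \<inter> ?H\<close> to the empty set. Decomposing \<open>N t\<close> according
    to the first visit to \<open>C\<close> after time \<open>t\<close> bounds the measure of the former by a multiple of that of the latter.\<close>
  define N where "N = (\<lambda>t. {x \<in> space M. (\<exists>k\<ge>t. walk T f i k x \<in> C) \<and> (\<forall>l\<in>{1..t}. walk T f i l x \<notin> J)})"
  define U where "U = (\<lambda>t k. {x \<in> space M. t \<le> k \<and> walk T f i k x \<in> C \<and> (\<forall>l\<in>{t..<k}. walk T f i l x \<notin> C) \<and>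
                      (\<forall>l\<in>{1..t}. walk T f i l x \<notin> J)})"
  have Nsets [measurable]: "N t \<in> sets M" for t unfolding N_def by measurable
  have Usets: "U t k \<in> sets M" for t k unfolding U_def by measurable
  have UN: "(\<Union>k. U t k) = N t" for t
  proof
    show "N t \<subseteq> (\<Union>k. U t k)"
    proof
      fix x assume x: "x \<in> N t"
      define k where "k = (LEAST k. t \<le> k \<and> walk T f i k x \<in> C)"
      have "t \<le> k \<and> walk T f i k x \<in> C"
        unfolding k_def by (rule LeastI_ex) (use x in \<open>auto simp: N_def\<close>)
      moreover have "\<not> (t \<le> l \<and> walk T f i l x \<in> C)" if "l < k" for l
        using not_less_Least that unfolding k_def by blast
      ultimately have "x \<in> U t k" using x unfolding U_def N_def by auto
      then show "x \<in> (\<Union>k. U t k)" by blast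
    qed
  qed (auto simp: U_def N_def)
  have disj: "disjoint_family (\<lambda>k. U t k \<inter> Y)" for t Y
    unfolding disjoint_family_on_def
  proof (intro ballI impI)
    fix k k' :: nat assume "k \<noteq> k'"
    then show "(U t k \<inter> Y) \<inter> (U t k' \<inter> Y) = {}"
      by (cases k k' rule: linorder_cases) (auto simp: U_def)
  qed
  have Nle: "emeasure M (N t) \<le> ?K * emeasure M (N t \<inter> ?H)" if "t \<ge> 1" for t
  proof -
    have le: "emeasure M (U t k) \<le> ?K * emeasure M (U t k \<inter> ?H)" for k
    proof (cases "t \<le> k")
      case True
      \<comment> \<open>As \<open>t \<le> k\<close>, every condition in \<open>U t k\<close>
        concerns times up to \<open>k\<close>. Also \<open>k \<ge> 1\<close>, since
        \<open>t \<ge> 1\<close>, so the estimate for cylinders ending in \<open>C\<close>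
        applies.\<close>
      have "determined k (U t k)"
        unfolding determined_def
      proof (intro conjI ballI impI)
        show "U t k \<subseteq> space M" by (auto simp: U_def)
        fix x y assume xy: "x \<in> U t k" "y \<in> space M" "same_cylinder k x y"
        then have "walk T f i l x = walk T f i l y" if "l \<le> k" for l
          using walk_same_cylinder[OF _ xy(2,3) that] by (simp add: U_def)
        then show "y \<in> U t k" using xy(1,2) True by (auto simp: U_def)
      qed
      then show ?thesis
        using True that by (intro emeasure_le_hit[where n = k, OF \<epsilon>]) (auto simp: U_def)
    next
      case False then show ?thesis by (simp add: U_def)
    qed
    have "emeasure M (N t) = (\<Sum>k. emeasure M (U t k))"
      using Usets disj[of t UNIV] by (subst suminf_emeasure) (auto simp: UN)
    also have "\<dots> \<le> (\<Sum>k. ?K * emeasure M (U t k \<inter> ?H))"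
      by (intro suminf_le le) auto
    also have "\<dots> = ?K * (\<Sum>k. emeasure M (U t k \<inter> ?H))" by simp
    also have "(\<Sum>k. emeasure M (U t k \<inter> ?H)) = emeasure M (\<Union>k. U t k \<inter> ?H)"
      using Usets disj by (intro suminf_emeasure) auto
    also have "(\<Union>k. U t k \<inter> ?H) = N t \<inter> ?H" using UN by blast
    finally show ?thesis .
  qed
  have Nanti: "N t \<subseteq> N s" if "s \<le> t" for s t
  proof
    fix x assume x: "x \<in> N t"
    then obtain k where "k \<ge> t" "walk T f i k x \<in> C" unfolding N_def by blast
    then have "\<exists>k\<ge>s. walk T f i k x \<in> C" using that le_trans by blast
    then show "x \<in> N s" using x that unfolding N_def by simp
  qed
  have "(\<lambda>t. emeasure M (N t \<inter> ?H)) \<longlonglongrightarrow> emeasure M (\<Inter>t. N t \<inter> ?H)"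
    using Nanti by (intro Lim_emeasure_decseq) (auto simp: decseq_def)
  \<comment> \<open>A point that visits \<open>J\<close> at time \<open>n \<ge> 1\<close> has left
    \<open>N t\<close> once \<open>t = n\<close>.\<close>
  moreover have "(\<Inter>t. N t \<inter> ?H) = {}"
  proof -
    have False if x: "\<And>t. x \<in> N t \<inter> ?H" for x
    proof -
      obtain n where "n \<ge> 1" "walk T f i n x \<in> J" using x by (auto simp: hit_def)
      then show False using x[of n] by (auto simp: N_def)
    qed
    then show ?thesis by blast
  qed
  ultimately have "(\<lambda>t. ?K * emeasure M (N t \<inter> ?H)) \<longlonglongrightarrow> ?K * 0"
    by (intro ennreal_tendsto_cmult) auto
  moreover have "emeasure M (\<Inter>t. N t) \<le> ?K * emeasure M (N t \<inter> ?H)" if "t \<ge> 1" for t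
    using Nle[OF that] by (rule order_trans[rotated]) (auto intro!: emeasure_mono)
  ultimately have "emeasure M (\<Inter>t. N t) \<le> ?K * 0"
    by (intro LIMSEQ_le_const) auto
  then have "emeasure M (\<Inter>t. N t) = 0" by simp
  then show ?thesis
  proof (intro AE_I)
    show "{x \<in> space M. \<not> ((\<exists>\<^sub>\<infinity>n. walk T f i n x \<in> C) \<longrightarrow> x \<in> ?H)} \<subseteq> (\<Inter>t. N t)"
      by (auto simp: N_def hit_def INFM_nat_le)
  qed (auto intro!: sets.countable_INT')
qed

section \<open>Uniform lower bounds from communication\<close>

lemma prob_communicate:
  assumes "a \<in> \<beta>" "b \<in> \<beta>"
  shows "0 < prob {x \<in> a. \<exists>n\<ge>1. (T ^^ n) x \<in> b \<and> walk T f p n x = j}"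
proof -
  let ?A = "{x \<in> a. \<exists>n\<ge>1. (T ^^ n) x \<in> b \<and> walk T f p n x = j}"
  interpret Z: sigma_finite_measure "count_space (UNIV :: int set)"
    by (rule sigma_finite_measure_count_space_countable) simp
  have [measurable]: "a \<in> sets M" "b \<in> sets M" using assms partition_sets by auto
  have "?A = {x \<in> space M. x \<in> a \<and> (\<exists>n\<ge>1. (T ^^ n) x \<in> b \<and> walk T f p n x = j)}"
    using sets.sets_into_space[of a M] by auto
  also have "\<dots> \<in> sets M" by measurable
  finally have A: "?A \<in> sets M" .
  have "communicates M T f (a \<times> {p}) (b \<times> {j})"
    using assms by (intro communicating) (auto simp: lifted_partition_def)
  moreover have "{z \<in> a \<times> {p}. \<exists>n\<ge>1. (skew_product T f ^^ n) z \<in> b \<times> {j}} = ?A \<times> {p}"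
    by (auto simp: skew_product_iter)
  ultimately have "0 < emeasure (M \<Otimes>\<^sub>M count_space UNIV) (?A \<times> {p})"
    by (simp add: communicates_def lifted_measure_def)
  \<comment> \<open>A single level of the product has counting measure 1.\<close>
  also have "\<dots> = emeasure M ?A"
    using A by (subst Z.emeasure_pair_measure_Times) auto
  finally show ?thesis by (simp add: emeasure_eq_measure)
qed

lemma prob_hit_pos:
  assumes "b \<in> \<beta>" shows "0 < prob (b \<inter> hit M T f p {j})"
proof -
  have "b \<subseteq> space M" using assms partition_sets sets.sets_into_space by blast
  then have "{x \<in> b. \<exists>n\<ge>1. (T ^^ n) x \<in> b \<and> walk T f p n x = j} \<subseteq> b \<inter> hit M T f p {j}"
    by (auto simp: hit_def)
  then have "prob {x \<in> b. \<exists>n\<ge>1. (T ^^ n) x \<in> b \<and> walk T f p n x = j} \<le> prob (b \<inter> hit M T f p {j})"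
    using partition_sets[OF assms] by (intro finite_measure_mono) auto
  with prob_communicate[OF assms assms] show ?thesis by (rule less_le_trans)
qed

text \<open>Every image of a partition element contains a member of \<open>net\<close>, so a lower
  bound over infinitely many images reduces to finitely many checks.\<close>

lemma prob_image_ge:
  assumes "a \<in> \<beta>" "E \<in> sets M" "\<And>b. b \<in> net \<Longrightarrow> \<epsilon> \<le> prob (b \<inter> E)"
  shows "\<epsilon> \<le> prob (T ` a \<inter> E)"
proof -
  obtain b where b: "b \<in> net" "b \<subseteq> T ` a" using net(3)[OF assms(1)] by blast
  then have "prob (b \<inter> E) \<le> prob (T ` a \<inter> E)"
    using image_partition(1)[OF assms(1)] assms(2) by (intro finite_measure_mono) auto
  then show ?thesis using assms(3)[OF b(1)] by linarith
qed

lemma AE_recurrent_finite_hit: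
  assumes "finite C"
  shows "AE x in M. (\<exists>\<^sub>\<infinity>n. walk T f i n x \<in> C) \<longrightarrow> x \<in> hit M T f i {j}"
proof -
  \<comment> \<open>The element 1 keeps the set nonempty, so that its minimum is meaningful even
    when \<open>C\<close> is empty.\<close>
  let ?S = "insert 1 ((\<lambda>(p, b). prob (b \<inter> hit M T f p {j})) ` (C \<times> net))"
  have fin: "finite ?S" using assms net(2) by simp
  have "0 < Min ?S"
    using fin prob_hit_pos net(1) by (subst Min_gr_iff) auto
  then show ?thesis
  proof (rule AE_recurrent_hit)
    fix p a assume "p \<in> C" "a \<in> \<beta>"
    then show "Min ?S \<le> prob (T ` a \<inter> hit M T f p {j})"
      using fin by (intro prob_image_ge Min_le) auto
  qed
qed

text \<open>A walk bounded above by \<open>K\<close> that stays above \<open>l\<close> from time 1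
  on remains in the finite window from \<open>l\<close> to \<open>K\<close>; recurrence to this
  window makes it hit \<open>l\<close> almost surely. There are countably many pairs
  \<open>l\<close>, \<open>K\<close>, so one null set serves all.\<close>

lemma AE_bounded_above_reaches:
  "AE x in M. x \<in> bounded_above M T f i \<longrightarrow> (\<forall>l. \<exists>n\<ge>1. walk T f i n x \<le> l)"
proof -
  have "AE x in M. \<forall>l K. (\<exists>\<^sub>\<infinity>n. walk T f i n x \<in> {l..K}) \<longrightarrow> x \<in> hit M T f i {l}"
    unfolding AE_all_countable by (intro allI AE_recurrent_finite_hit) simp
  then show ?thesis
  proof (rule eventually_mono, intro impI allI)
    fix x l assume hit: "\<forall>l K. (\<exists>\<^sub>\<infinity>n. walk T f i n x \<in> {l..K}) \<longrightarrow> x \<in> hit M T f i {l}"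
      and "x \<in> bounded_above M T f i"
    then obtain K where K: "walk T f i n x \<le> K" for n by (auto simp: bounded_above_def)
    show "\<exists>n\<ge>1. walk T f i n x \<le> l"
    proof (rule ccontr)
      assume neg: "\<not> ?thesis"
      then have in_lK: "walk T f i n x \<in> {l..K}" if "n \<ge> 1" for n
        using K[of n] that by force
      have "\<exists>\<^sub>\<infinity>n. walk T f i n x \<in> {l..K}"
        unfolding INFM_nat_le
      proof
        fix m show "\<exists>n\<ge>m. walk T f i n x \<in> {l..K}"
          using in_lK[of "Suc m"] by (intro exI[of _ "Suc m"]) auto
      qed
      then show False using hit neg by (force simp: hit_def)
    qed
  qed
qed

text \<open>Boundedness above does not depend on finitely many steps. Positivity at one site
  therefore spreads to every site and every partition element along a cylinder that leads there,
  with distortion controlling the loss of measure.\<close>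

lemma prob_bounded_above_pos:
  assumes pos: "0 < prob (bounded_above M T f i)" and b: "b \<in> \<beta>"
  shows "0 < prob (b \<inter> bounded_above M T f p)"
proof -
  let ?W = "bounded_above M T f"
  have "\<exists>a\<in>\<beta>. emeasure M (a \<inter> ?W i) \<noteq> 0"
  proof (rule ccontr)
    assume "\<not> ?thesis"
    then have "(\<Union>a\<in>\<beta>. a \<inter> ?W i) \<in> null_sets M"
      using countable_partition partition_sets by (intro null_sets_UN') (auto intro!: null_setsI)
    moreover have "(\<Union>a\<in>\<beta>. a \<inter> ?W i) = ?W i"
      using ex_partition by (auto simp: bounded_above_def)
    ultimately show False using pos by (simp add: measure_def null_setsD1)
  qed
  then obtain a where a: "a \<in> \<beta>" "emeasure M (a \<inter> ?W i) \<noteq> 0" by blast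
  note [measurable] = partition_sets[OF a(1)] partition_sets[OF b]
  let ?A = "\<lambda>n. {x \<in> space M. x \<in> b \<and> (T ^^ n) x \<in> a \<and> walk T f p n x = i}"
  have "\<exists>n\<ge>1. emeasure M (?A n) \<noteq> 0"
  proof (rule ccontr)
    assume neg: "\<not> ?thesis"
    have "(\<Union>n\<in>{1..}. ?A n) \<in> null_sets M"
      by (intro null_sets_UN') (use neg in \<open>auto intro!: null_setsI\<close>)
    moreover have "{x \<in> b. \<exists>n\<ge>1. (T ^^ n) x \<in> a \<and> walk T f p n x = i} = (\<Union>n\<in>{1..}. ?A n)"
      using sets.sets_into_space[OF partition_sets[OF b]] by auto
    ultimately show False
      using prob_communicate[OF b a(1), of p i] by (simp add: measure_def null_setsD1)
  qed
  then obtain n where n: "n \<ge> 1" "emeasure M (?A n) \<noteq> 0" by blast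
  \<comment> \<open>There are countably many cylinders of rank \<open>n\<close>, so one of them
    carries positive measure of the event; unlike the event, a whole cylinder can be handled by
    \<open>distortion\<close>.\<close>
  have "\<exists>c\<in>cyl n. emeasure M (c \<inter> ?A n) \<noteq> 0"
  proof (rule ccontr)
    assume "\<not> ?thesis"
    then have "(\<Union>c\<in>cyl n. c \<inter> ?A n) \<in> null_sets M"
      using countable_cylinders cylinders_sets by (intro null_sets_UN') (auto intro!: null_setsI)
    moreover have "(\<Union>c\<in>cyl n. c \<inter> ?A n) = ?A n"
      using ex_cylinder[of _ n] by auto
    ultimately show False using n(2) by (simp add: null_setsD1)
  qed
  then obtain c where c: "c \<in> cyl n" "emeasure M (c \<inter> ?A n) \<noteq> 0" by blast
  then have "c \<inter> ?A n \<noteq> {}" by force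
  then obtain x where x: "x \<in> c" "x \<in> ?A n" by blast
  have csp: "c \<subseteq> space M" and [measurable]: "c \<in> sets M"
    using cylinders_sets[OF c(1)] sets.sets_into_space by auto
  have cb: "c \<subseteq> b" using cylinders_subset_partition[OF c(1) n(1) x(1) _ b] x(2) by blast
  have wi: "walk T f p n y = i" if "y \<in> c" for y
    using walk_same_cylinder[OF _ _ same_cylinder_cyl[OF c(1) that x(1)] order_refl, of p] csp that x by auto
  obtain a' where a': "a' \<in> \<beta>" "(T ^^ n) ` c = T ` a'"
    using image_cylinder'[OF c(1) n(1)] x(1) by blast
  \<comment> \<open>The image of \<open>c\<close> is some \<open>T a'\<close> and contains the point
    \<open>(T ^^ n) x\<close> of \<open>a\<close>, hence all of \<open>a\<close>.\<close>
  have "a \<subseteq> (T ^^ n) ` c"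
    unfolding a'(2)
  proof (rule image_partition(2)[OF a'(1) a(1)])
    show "(T ^^ n) x \<in> a" using x(2) by blast
    show "(T ^^ n) x \<in> T ` a'" using x(1) a'(2) by blast
  qed
  then have sub: "a \<inter> ?W i \<inter> (T ^^ n) ` c = a \<inter> ?W i" by blast
  have "emeasure M c \<noteq> 0"
  proof
    assume "emeasure M c = 0"
    then have "emeasure M (c \<inter> ?A n) = 0"
      using emeasure_mono[of "c \<inter> ?A n" c M] by simp
    then show False using c(2) by simp
  qed
  then have "0 < emeasure M c * emeasure M (a \<inter> ?W i)"
    using a(2) by (simp add: zero_less_iff_neq_zero)
  also have "\<dots> \<le> ennreal distortion_const * emeasure M (c \<inter> ((T ^^ n) -` (a \<inter> ?W i) \<inter> space M))"
    using distortion[OF c(1) n(1), of "a \<inter> ?W i"] x(1) sub by auto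
  also have "c \<inter> ((T ^^ n) -` (a \<inter> ?W i) \<inter> space M) \<subseteq> b \<inter> ?W p"
  proof
    fix y assume y: "y \<in> c \<inter> ((T ^^ n) -` (a \<inter> ?W i) \<inter> space M)"
    then obtain K where K: "walk T f i k ((T ^^ n) y) \<le> K" for k
      by (auto simp: bounded_above_def)
    \<comment> \<open>The first \<open>n\<close> steps visit finitely many sites and can only
      enlarge the bound.\<close>
    have "walk T f p k y \<le> max K (Max ((\<lambda>k. walk T f p k y) ` {..n}))" for k
    proof (cases "k \<le> n")
      case True
      then show ?thesis by (intro max.coboundedI2 Max_ge) auto
    next
      case False
      then have "walk T f p k y = walk T f i (k - n) ((T ^^ n) y)"
        using walk_add[of T f p "k - n" n y] wi[of y] y by simp
      then show ?thesis using K by (simp add: max.coboundedI1)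
    qed
    then show "y \<in> b \<inter> ?W p" using y cb csp by (auto simp: bounded_above_def)
  qed
  then have "ennreal distortion_const * emeasure M (c \<inter> ((T ^^ n) -` (a \<inter> ?W i) \<inter> space M)) \<le>
      ennreal distortion_const * emeasure M (b \<inter> ?W p)"
    by (intro mult_left_mono emeasure_mono) auto
  finally have "emeasure M (b \<inter> ?W p) \<noteq> 0" by (auto simp: zero_less_iff_neq_zero)
  then show ?thesis by (simp add: emeasure_eq_measure zero_less_measure_iff)
qed

section \<open>Crossing windows: walks unbounded below and walks that hit every site\<close>

lemma walk_step: "x \<in> space M \<Longrightarrow> \<bar>walk T f i (Suc n) x - walk T f i n x\<bar> \<le> L"
  using f_bounded[OF iter_space] by (simp add: walk_Suc)

text \<open>A walk bounded above reaches every low level anyway. Any other walk enters infinitely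
  many windows to the right, and from each of them it has a chance of at least about \<epsilon> to
  be bounded above from then on and so to come down to any level \<open>l\<close>.\<close>

lemma AE_unbounded_below:
  assumes K: "infinite K" and \<epsilon>: "\<epsilon> > 0"
    and le: "\<And>k i b. k \<in> K \<Longrightarrow> i \<in> {0..L} \<Longrightarrow> b \<in> net \<Longrightarrow> \<epsilon> \<le> prob (b \<inter> bounded_above M T f (int k + i))"
  shows "AE x in M. x \<notin> bounded_below M T f p"
proof -
  \<comment> \<open>Windows of \<open>L + 1\<close> sites, over which no jump can leap.\<close>
  define C where "C = {int k + i | k i. k \<in> K \<and> i \<in> {0..L}}"
  have io: "\<exists>\<^sub>\<infinity>n. walk T f p n x \<in> C" if x: "x \<in> space M" "x \<notin> bounded_above M T f p" for x
    unfolding INFM_nat_le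
  proof
    fix N
    define m where "m = Max ((\<lambda>k. walk T f p k x) ` {..N})"
    have m: "walk T f p k x \<le> m" if "k \<le> N" for k
      unfolding m_def using that by (intro Max_ge) auto
    \<comment> \<open>A level beyond all positions up to time \<open>N\<close> is reached only after
      time \<open>N\<close>.\<close>
    obtain k where k: "k \<in> K" "nat m < k"
      using K unfolding infinite_nat_iff_unbounded by blast
    have "\<exists>n. walk T f p n x \<ge> int k"
    proof (rule ccontr)
      assume "\<not> ?thesis"
      then have "\<forall>n. walk T f p n x \<le> int k" by (auto simp: not_le intro: less_imp_le)
      then show False using x by (auto simp: bounded_above_def)
    qed
    then have n: "walk T f p (LEAST n. walk T f p n x \<ge> int k) x \<ge> int k" (is "walk T f p ?n x \<ge> _")
      by (rule LeastI_ex)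
    have nN: "?n > N" using m[of ?n] n k(2) by linarith
    then obtain n' where n': "?n = Suc n'" by (cases ?n) auto
    have "walk T f p n' x < int k"
      using not_less_Least[of n' "\<lambda>n. walk T f p n x \<ge> int k"] n' by simp
    \<comment> \<open>One step before the first passage the walk is still below \<open>k\<close>,
      which limits the overshoot.\<close>
    then have "walk T f p ?n x \<le> int k + L"
      using walk_step[OF x(1), of p n'] unfolding n' by linarith
    then have "walk T f p ?n x \<in> C"
      unfolding C_def using n k(1) by (intro CollectI exI[of _ k] exI[of _ "walk T f p ?n x - int k"]) auto
    then show "\<exists>n\<ge>N. walk T f p n x \<in> C" using nN by (intro exI[of _ ?n]) auto
  qed
  have "AE x in M. (\<exists>\<^sub>\<infinity>n. walk T f p n x \<in> C) \<longrightarrow> x \<in> hit M T f p {..l}" for l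
  proof (rule AE_recurrent_hit[OF \<epsilon>])
    fix q a assume "q \<in> C" and a: "a \<in> \<beta>"
    then obtain k i where q: "q = int k + i" "k \<in> K" "i \<in> {0..L}" by (auto simp: C_def)
    show "\<epsilon> \<le> prob (T ` a \<inter> hit M T f q {..l})"
    proof (rule prob_image_ge[OF a hit_sets])
      fix b assume b: "b \<in> net"
      then have [measurable]: "b \<in> sets M" using net(1) partition_sets by blast
      have "AE x in M. x \<in> b \<inter> bounded_above M T f q \<longrightarrow> x \<in> b \<inter> hit M T f q {..l}"
        using AE_bounded_above_reaches[of q]
        by (rule eventually_mono) (auto simp: hit_def bounded_above_def)
      then have "prob (b \<inter> bounded_above M T f q) \<le> prob (b \<inter> hit M T f q {..l})"
        by (intro finite_measure_mono_AE) auto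
      then show "\<epsilon> \<le> prob (b \<inter> hit M T f q {..l})"
        using le[OF q(2,3) b, folded q(1)] by linarith
    qed
  qed
  then have "AE x in M. \<forall>l. (\<exists>\<^sub>\<infinity>n. walk T f p n x \<in> C) \<longrightarrow> x \<in> hit M T f p {..l}"
    unfolding AE_all_countable by blast
  then have reach: "AE x in M. \<forall>l. \<exists>n\<ge>1. walk T f p n x \<le> l"
    using AE_bounded_above_reaches[of p] AE_space
  proof eventually_elim
    case (elim x)
    show ?case
    proof (cases "x \<in> bounded_above M T f p")
      case False
      then have "\<forall>l. x \<in> hit M T f p {..l}" using elim io[of x] by blast
      then show ?thesis by (auto simp: hit_def)
    qed (use elim in blast)
  qed
  show ?thesis
    using reach
  proof (rule eventually_mono)
    fix x assume r: "\<forall>l. \<exists>n\<ge>1. walk T f p n x \<le> l"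
    show "x \<notin> bounded_below M T f p"
    proof
      assume "x \<in> bounded_below M T f p"
      then obtain l where l: "\<And>n. l \<le> walk T f p n x" by (auto simp: bounded_below_def)
      obtain n where "walk T f p n x \<le> l - 1" using r by blast
      then show False using l[of n] by linarith
    qed
  qed
qed

text \<open>A walk that eventually avoids the window of radius \<open>L\<close> around
  \<open>j\<close> cannot change sides any more, hence is bounded on one side. An oscillating walk
  thus returns to the window infinitely often, and recurrence to a finite set gives the hit.\<close>

lemma AE_hit:
  assumes "AE x in M. x \<notin> bounded_above M T f p" "AE x in M. x \<notin> bounded_below M T f p"
  shows "AE x in M. x \<in> hit M T f p {j}"
proof -
  let ?C = "{j - L..j + L}"
  have io: "\<exists>\<^sub>\<infinity>n. walk T f p n x \<in> ?C"
    if x: "x \<in> space M" "x \<notin> bounded_above M T f p" "x \<notin> bounded_below M T f p" for x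
  proof (rule ccontr)
    let ?w = "\<lambda>n. walk T f p n x"
    assume "\<not> ?thesis"
    then obtain N where N: "?w n \<notin> ?C" if "n \<ge> N" for n
      unfolding INFM_nat_le by blast
    have L: "L \<ge> 0" using walk_step[OF x(1), of p 0] by linarith
    have fin: "\<exists>l u. \<forall>n\<le>N. l \<le> ?w n \<and> ?w n \<le> u"
      by (intro exI[of _ "Min (?w ` {..N})"] exI[of _ "Max (?w ` {..N})"]) auto
    then obtain l u where lu: "\<And>n. n \<le> N \<Longrightarrow> l \<le> ?w n \<and> ?w n \<le> u" by blast
    show False
    proof (cases "?w N > j")
      case True
      have "?w n > j" if "n \<ge> N" for n
        using that
      proof (induction rule: dec_induct)
        case (step n)
        then show ?case using N[of n] N[of "Suc n"] walk_step[OF x(1), of p n] by auto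
      qed (rule True)
      then have "min l j \<le> ?w n" for n
        using lu[of n] \<open>\<And>n. N \<le> n \<Longrightarrow> ?w n > j\<close>[of n] by (cases "n \<le> N") (auto simp: min_le_iff_disj intro: less_imp_le)
      then show False using x by (auto simp: bounded_below_def)
    next
      case False
      have "?w n \<le> j" if "n \<ge> N" for n
        using that
      proof (induction rule: dec_induct)
        case (step n)
        then show ?case using N[of n] N[of "Suc n"] walk_step[OF x(1), of p n] L by auto
      qed (use False in simp)
      then have "?w n \<le> max u j" for n
        using lu[of n] \<open>\<And>n. N \<le> n \<Longrightarrow> ?w n \<le> j\<close>[of n] by (cases "n \<le> N") (auto simp: le_max_iff_disj)
      then show False using x by (auto simp: bounded_above_def)
    qed
  qed
  have "AE x in M. (\<exists>\<^sub>\<infinity>n. walk T f p n x \<in> ?C) \<longrightarrow> x \<in> hit M T f p {j}"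
    by (rule AE_recurrent_finite_hit) simp
  then show ?thesis
    using assms AE_space by eventually_elim (use io in blast)
qed

end

section \<open>Recurrence and reflection of the environment\<close>

lemma (in prob_space) indep_vars_reindex:
  assumes h: "inj_on h I" and X: "indep_vars M' X (h ` I)"
  shows "indep_vars (\<lambda>i. M' (h i)) (\<lambda>i. X (h i)) I"
  unfolding indep_vars_def2
proof (intro conjI ballI)
  show "random_variable (M' (h i)) (X (h i))" if "i \<in> I" for i
    using X that unfolding indep_vars_def2 by blast
  let ?F = "\<lambda>k. {X k -` A \<inter> space M |A. A \<in> sets (M' k)}"
  have F: "indep_sets ?F (h ` I)" using X unfolding indep_vars_def2 by blast
  show "indep_sets (\<lambda>i. ?F (h i)) I"
  proof (rule indep_setsI)
    show "?F (h i) \<subseteq> events" if "i \<in> I" for i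
      using F that unfolding indep_sets_def by blast
    fix A J assume J: "J \<noteq> {}" "J \<subseteq> I" "finite J" "\<forall>j\<in>J. A j \<in> ?F (h j)"
    define g where "g = the_inv_into I h"
    have g: "g (h j) = j" if "j \<in> J" for j
      unfolding g_def using h J(2) that by (auto intro: the_inv_into_f_f)
    have "prob (\<Inter>k\<in>h ` J. A (g k)) = (\<Prod>k\<in>h ` J. prob (A (g k)))"
    proof (rule indep_setsD[OF F])
      show "\<forall>k\<in>h ` J. A (g k) \<in> ?F k"
      proof
        fix k assume "k \<in> h ` J"
        then obtain j where j: "j \<in> J" "k = h j" by blast
        then have "A j \<in> ?F (h j)" using J(4) by blast
        then show "A (g k) \<in> ?F k" using j g by simp
      qed
    qed (use J in auto)
    moreover have "(\<Inter>k\<in>h ` J. A (g k)) = (\<Inter>j\<in>J. A j)" using g by simp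
    moreover have "(\<Prod>k\<in>h ` J. prob (A (g k))) = (\<Prod>j\<in>J. prob (A j))"
      using g by (subst prod.reindex[OF inj_on_subset[OF h J(2)]]) simp
    ultimately show "prob (\<Inter>j\<in>J. A j) = (\<Prod>j\<in>J. prob (A j))" by simp
  qed
qed

lemma funpow_measurable: "h \<in> measurable P P \<Longrightarrow> h ^^ n \<in> measurable P P"
proof (induction n)
  case 0 then show ?case by (simp add: id_def)
next
  case (Suc n) then show ?case unfolding funpow.simps(2) by (auto intro: measurable_comp)
qed

text \<open>The set of points that visit \<Gamma> infinitely often is strictly invariant, and by
  stationarity its measure is at least that of \<Gamma>; ergodicity leaves only the value 1.\<close>

lemma (in prob_space) ergodic_recurrence:
  assumes \<eta>: "\<eta> \<in> measurable M M" and "ergodic_env M \<eta>" "stationary_env M \<eta>"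
    and \<Gamma>: "\<Gamma> \<in> sets M" "prob \<Gamma> > 0"
  shows "AE \<omega> in M. \<exists>\<^sub>\<infinity>k. (\<eta> ^^ k) \<omega> \<in> \<Gamma>"
proof -
  have \<eta>k [measurable]: "\<eta> ^^ k \<in> measurable M M" for k using funpow_measurable[OF \<eta>] .
  note [measurable] = \<Gamma>(1)
  have step: "prob (\<eta> -` A \<inter> space M) = prob A" if "A \<in> sets M" for A
    using assms(3) measure_distr[OF \<eta> that] by (simp add: stationary_env_def)
  have pres: "prob ((\<eta> ^^ k) -` \<Gamma> \<inter> space M) = prob \<Gamma>" for k
  proof (induction k)
    case 0
    then show ?case using sets.sets_into_space[OF \<Gamma>(1)] by (simp add: Int_absorb2)
  next
    case (Suc k)
    have "(\<eta> ^^ Suc k) -` \<Gamma> \<inter> space M = \<eta> -` ((\<eta> ^^ k) -` \<Gamma> \<inter> space M) \<inter> space M"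
      using measurable_space[OF \<eta>] by (auto simp: funpow_swap1)
    moreover have "(\<eta> ^^ k) -` \<Gamma> \<inter> space M \<in> events" by measurable
    ultimately show ?case using Suc step by (simp only:)
  qed
  define V where "V = (\<lambda>n. {\<omega> \<in> space M. \<exists>k\<ge>n. (\<eta> ^^ k) \<omega> \<in> \<Gamma>})"
  have V [measurable]: "V n \<in> sets M" for n unfolding V_def by measurable
  have dec: "decseq V" unfolding decseq_def V_def using le_trans by blast
  have "(\<lambda>n. prob (V n)) \<longlonglongrightarrow> prob (\<Inter>n. V n)"
    using dec by (intro finite_Lim_measure_decseq) auto
  moreover have "prob \<Gamma> \<le> prob (V n)" for n
    unfolding pres[of n, symmetric] by (intro finite_measure_mono V) (auto simp: V_def)
  ultimately have "prob \<Gamma> \<le> prob (\<Inter>n. V n)"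
    by (intro LIMSEQ_le_const) auto
  moreover have VI: "(\<Inter>n. V n) = {\<omega> \<in> space M. \<exists>\<^sub>\<infinity>k. (\<eta> ^^ k) \<omega> \<in> \<Gamma>}"
    by (auto simp: V_def INFM_nat_le)
  moreover have "\<eta> -` (\<Inter>n. V n) \<inter> space M = (\<Inter>n. V n)"
  proof -
    have "(\<exists>\<^sub>\<infinity>k. (\<eta> ^^ k) (\<eta> \<omega>) \<in> \<Gamma>) \<longleftrightarrow> (\<exists>\<^sub>\<infinity>k. (\<eta> ^^ k) \<omega> \<in> \<Gamma>)" for \<omega>
      using MOST_Suc_iff[of "\<lambda>k. (\<eta> ^^ k) \<omega> \<notin> \<Gamma>"]
      unfolding frequently_def funpow_Suc_right comp_apply by blast
    then show ?thesis unfolding VI using measurable_space[OF \<eta>] by auto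
  qed
  then have "prob (\<Inter>n. V n) = 0 \<or> prob (\<Inter>n. V n) = 1"
    using assms(2) V unfolding ergodic_env_def by blast
  ultimately have "prob {\<omega> \<in> space M. \<exists>\<^sub>\<infinity>k. (\<eta> ^^ k) \<omega> \<in> \<Gamma>} = 1" using \<Gamma>(2) by auto
  then show ?thesis by (auto dest: AE_prob_1)
qed

section \<open>Translated and reflected environments\<close>

lemma walk_translate:
  assumes "\<And>i x. x \<in> X \<Longrightarrow> g i x = f (i + k) x" "\<And>n. (T ^^ n) x \<in> X"
  shows "walk T g i n x = walk T f (i + k) n x - k"
  using assms by (induction n) (simp_all add: walk_0 walk_Suc)

lemma walk_reflect:
  assumes "\<And>i x. x \<in> X \<Longrightarrow> g i x = - f (- i) x" "\<And>n. (T ^^ n) x \<in> X"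
  shows "walk T g i n x = - walk T f (- i) n x"
  using assms by (induction n) (simp_all add: walk_0 walk_Suc)

lemma (in markov_map) bounded_above_translate:
  assumes "\<And>i x. x \<in> space M \<Longrightarrow> g i x = f (i + k) x"
  shows "bounded_above M T g i = bounded_above M T f (i + k)"
proof -
  have w: "walk T g i n x = walk T f (i + k) n x - k" if "x \<in> space M" for n x
    using assms iter_space[OF that] by (rule walk_translate)
  have "(\<exists>K. \<forall>n. walk T g i n x \<le> K) \<longleftrightarrow> (\<exists>K. \<forall>n. walk T f (i + k) n x \<le> K)" if "x \<in> space M" for x
  proof
    assume "\<exists>K. \<forall>n. walk T g i n x \<le> K"
    then obtain K where "\<And>n. walk T g i n x \<le> K" by blast
    then show "\<exists>K. \<forall>n. walk T f (i + k) n x \<le> K"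
      by (intro exI[of _ "K + k"]) (simp add: w[OF that] diff_le_eq)
  next
    assume "\<exists>K. \<forall>n. walk T f (i + k) n x \<le> K"
    then obtain K where "\<And>n. walk T f (i + k) n x \<le> K" by blast
    then show "\<exists>K. \<forall>n. walk T g i n x \<le> K"
      by (intro exI[of _ "K - k"]) (simp add: w[OF that])
  qed
  then show ?thesis by (auto simp: bounded_above_def)
qed

lemma (in markov_map) bounded_above_reflect:
  assumes "\<And>i x. x \<in> space M \<Longrightarrow> g i x = - f (- i) x"
  shows "bounded_above M T g i = bounded_below M T f (- i)"
proof -
  have w: "walk T g i n x = - walk T f (- i) n x" if "x \<in> space M" for n x
    using assms iter_space[OF that] by (rule walk_reflect)
  have "(\<exists>K. \<forall>n. walk T g i n x \<le> K) \<longleftrightarrow> (\<exists>K. \<forall>n. K \<le> walk T f (- i) n x)" if "x \<in> space M" for x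
  proof
    assume "\<exists>K. \<forall>n. walk T g i n x \<le> K"
    then obtain K where "\<And>n. walk T g i n x \<le> K" by blast
    then show "\<exists>K. \<forall>n. K \<le> walk T f (- i) n x"
      by (intro exI[of _ "- K"]) (simp add: w[OF that] minus_le_iff)
  next
    assume "\<exists>K. \<forall>n. K \<le> walk T f (- i) n x"
    then obtain K where "\<And>n. K \<le> walk T f (- i) n x" by blast
    then show "\<exists>K. \<forall>n. walk T g i n x \<le> K"
      by (intro exI[of _ "- K"]) (simp add: w[OF that])
  qed
  then show ?thesis by (auto simp: bounded_above_def bounded_below_def)
qed

section \<open>Coding environments by integer arrays\<close>

context markov_map
begin

definition cell :: "'x \<Rightarrow> 'x set" where
  "cell x = (THE b. b \<in> \<beta> \<and> x \<in> b)"

lemma cell_eq: "b \<in> \<beta> \<Longrightarrow> x \<in> b \<Longrightarrow> cell x = b"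
  unfolding cell_def by (rule the_equality) (auto dest: partition_unique)

lemma cell: "x \<in> space M \<Longrightarrow> cell x \<in> \<beta>" "x \<in> space M \<Longrightarrow> x \<in> cell x"
  using ex_partition cell_eq by auto

definition rep :: "'x set \<Rightarrow> 'x" where
  "rep b = (SOME x. x \<in> b)"

lemma rep: "b \<in> \<beta> \<Longrightarrow> rep b \<in> b" "b \<in> \<beta> \<Longrightarrow> rep b \<in> space M"
proof -
  assume b: "b \<in> \<beta>"
  then have "b \<noteq> {}" using partition by (auto simp: partition_on_def)
  then show "rep b \<in> b" unfolding rep_def by (auto intro: someI)
  then show "rep b \<in> space M" using partition_sets[OF b] sets.sets_into_space by blast
qed

lemma cell_measurable [measurable]: "cell \<in> measurable M (count_space \<beta>)"
proof -
  have "cell -` {b} \<inter> space M = b" if "b \<in> \<beta>" for b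
    using cell cell_eq[OF that] sets.sets_into_space[OF partition_sets[OF that]] by blast
  then show ?thesis
    using cell partition_sets countable_partition by (subst measurable_count_space_eq_countable) auto
qed

text \<open>Neither closure of \<open>G\<close> under negation nor measurability of the set of negatives is assumed, so the
  laws of the environment and of its reflection are compared on a larger space: a transition function
  is encoded by its values on the elements of \<open>\<beta>\<close>.\<close>

abbreviation code_fun :: "('x set \<Rightarrow> int) measure" where
  "code_fun \<equiv> PiM \<beta> (\<lambda>_. count_space UNIV)"

abbreviation code_env :: "(int \<Rightarrow> 'x set \<Rightarrow> int) measure" where
  "code_env \<equiv> PiM UNIV (\<lambda>_. code_fun)"

definition encode :: "('x \<Rightarrow> int) \<Rightarrow> 'x set \<Rightarrow> int" where
  "encode g = (\<lambda>b\<in>\<beta>. g (rep b))"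

text \<open>Meaningful for arbitrary arrays, in particular for reflected ones, whose transition
  functions need not lie in \<open>G\<close>.\<close>

definition decode :: "(int \<Rightarrow> 'x set \<Rightarrow> int) \<Rightarrow> int \<Rightarrow> 'x \<Rightarrow> int" where
  "decode F i x = F i (cell x)"

text \<open>Joint measurability in environment and starting point. The next jump is an array entry
  whose two indices, the current site and the current cell, are random but take countably many
  values.\<close>

lemma walk_decode_measurable:
  "(\<lambda>z. walk T (decode (fst z)) i n (snd z)) \<in> measurable (code_env \<Otimes>\<^sub>M M) (count_space UNIV)"
proof (induction n)
  case 0 then show ?case by (simp add: walk_0)
next
  case (Suc n)
  let ?N = "code_env \<Otimes>\<^sub>M M"
  note Suc [measurable]
  have 1: "(\<lambda>z. fst z p b) \<in> measurable ?N (count_space UNIV)" if "b \<in> \<beta>" for p b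
  proof -
    have "(\<lambda>F. F p b) \<in> measurable code_env (count_space UNIV)"
    proof (rule measurable_compose[where f = "\<lambda>F. F p" and g = "\<lambda>g. g b"])
      show "(\<lambda>F. F p) \<in> measurable code_env code_fun" by (rule measurable_component_singleton) simp
      show "(\<lambda>g. g b) \<in> measurable code_fun (count_space UNIV)"
        using that by (rule measurable_component_singleton)
    qed
    from measurable_compose[OF measurable_fst this] show ?thesis .
  qed
  have 2: "(\<lambda>z. fst z p (cell ((T ^^ n) (snd z)))) \<in> measurable ?N (count_space UNIV)" for p
    by (rule measurable_compose_countable'[where I = \<beta> and g = "\<lambda>z. cell ((T ^^ n) (snd z))", OF 1])
      (use countable_partition in \<open>simp_all\<close>)
  have 3: "(\<lambda>z. fst z (walk T (decode (fst z)) i n (snd z)) (cell ((T ^^ n) (snd z)))) \<in> measurable ?N (count_space UNIV)"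
    by (rule measurable_compose_countable'[where I = UNIV and g = "\<lambda>z. walk T (decode (fst z)) i n (snd z)", OF 2])
      (use Suc in simp_all)
  note [measurable] = 3
  show ?case
    unfolding walk_Suc decode_def[of _ "walk _ _ _ _ _"] by measurable
qed

lemma bounded_above_decode_measurable:
  assumes "B \<in> sets M"
  shows "(\<lambda>F. emeasure M (B \<inter> bounded_above M T (decode F) i)) \<in> borel_measurable code_env"
proof -
  note [measurable] = walk_decode_measurable assms
  let ?Q = "{z \<in> space (code_env \<Otimes>\<^sub>M M). snd z \<in> B \<and> (\<exists>K. \<forall>n. walk T (decode (fst z)) i n (snd z) \<le> K)}"
  have "?Q \<in> sets (code_env \<Otimes>\<^sub>M M)" by measurable
  then have "(\<lambda>F. emeasure M (Pair F -` ?Q)) \<in> borel_measurable code_env"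
    by (rule measurable_emeasure_Pair)
  moreover have "Pair F -` ?Q = B \<inter> bounded_above M T (decode F) i" if "F \<in> space code_env" for F
    using that by (auto simp: bounded_above_def space_pair_measure)
  ultimately show ?thesis by (simp cong: measurable_cong)
qed

end

section \<open>The law of the environment and of its reflection\<close>

context dwde
begin

abbreviation env_at :: "'w \<Rightarrow> int \<Rightarrow> 'x \<Rightarrow> int" where
  "env_at \<equiv> env P \<eta> \<phi>"

lemma constant_on_partition: "g \<in> G \<Longrightarrow> b \<in> \<beta> \<Longrightarrow> g constant_on b"
  using transition_functions by (auto simp: transition_functions_def)

lemma env_in_G: "\<omega> \<in> space P \<Longrightarrow> env_at \<omega> i \<in> G"
  using measurable_space[OF measurable_env_at] by (simp add: space_transition_borel)

lemma encode_cell: "g \<in> G \<Longrightarrow> x \<in> space M \<Longrightarrow> encode g (cell x) = g x"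
  using constant_on_partition[of g "cell x"] cell[of x] rep(1)[of "cell x"]
  by (auto simp: encode_def constant_on_def)

text \<open>If \<alpha> lists \<open>b\<close> at place \<open>j\<close>, functions at distance less
  than \<open>(1/2) ^ j\<close> agree on the first \<open>j\<close> elements, hence at
  \<open>x\<close>.\<close>

lemma openin_evaluation:
  assumes "b \<in> \<beta>" "x \<in> b"
  shows "openin (transition_topology \<beta> \<alpha> G) {g \<in> G. g x = k}"
proof (cases "finite \<beta>")
  case True then show ?thesis by (auto simp: transition_topology_def)
next
  case False
  interpret Metric_space G "transition_dist \<alpha>" by (rule transition_metric[OF False])
  obtain j where j: "j \<ge> 1" "\<alpha> j = b"
    using enumeration[OF False] assms(1) by (auto simp: bij_betw_def image_iff)
  have eq: "h x = k" if g: "g \<in> G" "g x = k" and h: "h \<in> mball g ((1/2) ^ j)" for g h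
  proof (cases "g = h")
    case True then show ?thesis using g by simp
  next
    case ne: False
    let ?A = "{n. \<forall>j\<in>{1..n}. \<forall>x\<in>\<alpha> j. g x = h x}"
    have hG: "h \<in> G" using h by simp
    have "finite ?A" using finite_agreement[OF False g(1) hG ne] .
    moreover have "0 \<in> ?A" by simp
    ultimately have "Max ?A \<in> ?A" using Max_in by blast
    then have agree: "g x = h x" if "i \<in> {1..Max ?A}" "x \<in> \<alpha> i" for i x using that by blast
    have "(1/2::real) ^ Max ?A < (1/2) ^ j"
      using h ne by (simp add: transition_dist_def)
    then have "j < Max ?A" using power_strict_decreasing_iff[of "1/2::real"] by simp
    then have "g x = h x" using agree[of j x] j assms(2) by simp
    then show ?thesis using g(2) by simp
  qed
  then have "openin mtopology {g \<in> G. g x = k}"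
    unfolding openin_mtopology
  proof (intro conjI allI impI)
    fix g assume "g \<in> {g \<in> G. g x = k}"
    then have "mball g ((1/2) ^ j) \<subseteq> {g \<in> G. g x = k}"
      using eq[of g] mball_subset_mspace by blast
    then show "\<exists>r>0. mball g r \<subseteq> {g \<in> G. g x = k}" by (intro exI[of _ "(1/2) ^ j"]) simp
  qed auto
  then show ?thesis using False by (simp add: transition_topology_def)
qed

lemma evaluation_measurable:
  assumes "b \<in> \<beta>" "x \<in> b"
  shows "(\<lambda>g. g x) \<in> measurable (transition_borel \<beta> \<alpha> G) (count_space UNIV)"
proof -
  let ?t = "transition_topology \<beta> \<alpha> G"
  have top: "topspace ?t = G"
    using Metric_space.topspace_mtopology[OF transition_metric]
    by (auto simp: transition_topology_def)
  have sub: "{U. openin ?t U} \<subseteq> Pow G" using openin_subset top by fastforce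
  have "(\<lambda>g. g x) -` {k} \<inter> G \<in> sets (transition_borel \<beta> \<alpha> G)" for k
  proof -
    have "(\<lambda>g. g x) -` {k} \<inter> G = {g \<in> G. g x = k}" by auto
    then show ?thesis
      using openin_evaluation[OF assms, of k] sub by (simp add: transition_borel_def)
  qed
  then show ?thesis
    by (subst measurable_count_space_eq2_countable) (auto simp: space_transition_borel)
qed

lemma encode_measurable: "encode \<in> measurable (transition_borel \<beta> \<alpha> G) code_fun"
proof -
  have "(\<lambda>g. \<lambda>b\<in>\<beta>. g (rep b)) \<in> measurable (transition_borel \<beta> \<alpha> G) code_fun"
    by (rule measurable_restrict) (rule evaluation_measurable[OF _ rep(1)])
  then show ?thesis by (simp add: encode_def[abs_def])
qed

definition code :: "'w \<Rightarrow> int \<Rightarrow> 'x set \<Rightarrow> int" where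
  "code \<omega> i = encode (env_at \<omega> i)"

definition reflected_code :: "'w \<Rightarrow> int \<Rightarrow> 'x set \<Rightarrow> int" where
  "reflected_code \<omega> i = (\<lambda>b\<in>\<beta>. - code \<omega> (- i) b)"

lemma code_at_measurable: "(\<lambda>\<omega>. code \<omega> i) \<in> measurable P code_fun"
  unfolding code_def by (rule measurable_compose[OF measurable_env_at encode_measurable])

lemma neg_code_measurable: "(\<lambda>F. \<lambda>b\<in>\<beta>. - F b) \<in> measurable code_fun code_fun"
proof (rule measurable_restrict)
  fix b assume "b \<in> \<beta>"
  then have "(\<lambda>F. F b) \<in> measurable code_fun (count_space UNIV)"
    by (rule measurable_component_singleton)
  then show "(\<lambda>F. - F b) \<in> measurable code_fun (count_space UNIV)"
    by (rule measurable_compose) simp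
qed

lemma reflected_code_at_measurable: "(\<lambda>\<omega>. reflected_code \<omega> i) \<in> measurable P code_fun"
  unfolding reflected_code_def by (rule measurable_compose[OF code_at_measurable neg_code_measurable])

lemma code_measurable: "code \<in> measurable P code_env"
  and reflected_code_measurable: "reflected_code \<in> measurable P code_env"
proof -
  have "(\<lambda>\<omega>. \<lambda>i\<in>UNIV. code \<omega> i) \<in> measurable P code_env"
    using code_at_measurable by (rule measurable_restrict)
  then show "code \<in> measurable P code_env" by (simp add: restrict_def)
  have "(\<lambda>\<omega>. \<lambda>i\<in>UNIV. reflected_code \<omega> i) \<in> measurable P code_env"
    using reflected_code_at_measurable by (rule measurable_restrict)
  then show "reflected_code \<in> measurable P code_env" by (simp add: restrict_def)
qed

text \<open>Symmetry compares the events \<open>A\<close> and \<open>neg_on\<close> of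
  \<open>A\<close> for Borel sets \<open>A\<close> of \<open>G\<close>. Taking \<open>A = G\<close>
  first shows that almost surely the negative of the transition function is again in
  \<open>G\<close>; on that event reflection is the negation of a member of \<open>G\<close>.
  Equality of the laws at \<open>i\<close> and \<open>- i\<close> does the rest.\<close>

lemma distr_reflected_code_at:
  assumes iid: "iid_env \<beta> \<alpha> G P \<eta> \<phi>" and sym: "symmetric_env (space M) \<beta> \<alpha> G P \<eta> \<phi>"
  shows "distr P code_fun (\<lambda>\<omega>. reflected_code \<omega> i) = distr P code_fun (\<lambda>\<omega>. code \<omega> i)"
proof -
  let ?tb = "transition_borel \<beta> \<alpha> G" and ?N = "neg_on (space M)"
  have dist: "distr P code_fun (\<lambda>\<omega>. code \<omega> j) = distr (distr P ?tb (\<lambda>\<omega>. env_at \<omega> j)) code_fun encode" for j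
    by (subst distr_distr[OF encode_measurable measurable_env_at]) (simp add: code_def[abs_def] comp_def)
  have "distr P ?tb (\<lambda>\<omega>. env_at \<omega> i) = distr P ?tb (\<lambda>\<omega>. env_at \<omega> (- i))"
    using iid unfolding iid_env_def by blast
  then have "distr P code_fun (\<lambda>\<omega>. code \<omega> i) = distr P code_fun (\<lambda>\<omega>. code \<omega> (- i))"
    unfolding dist by simp
  moreover have "distr P code_fun (\<lambda>\<omega>. reflected_code \<omega> i) = distr P code_fun (\<lambda>\<omega>. code \<omega> (- i))"
  proof (rule measure_eqI)
    fix E assume "E \<in> sets (distr P code_fun (\<lambda>\<omega>. reflected_code \<omega> i))"
    then have E: "E \<in> sets code_fun" by simp
    define A where "A = encode -` E \<inter> space ?tb"
    have A: "A \<in> sets ?tb" unfolding A_def by (rule measurable_sets[OF encode_measurable E])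
    let ?f = "\<lambda>\<omega>. env_at \<omega> (- i)"
    let ?S = "{\<omega> \<in> space P. ?f \<omega> \<in> ?N ` G}"
    let ?R = "{\<omega> \<in> space P. reflected_code \<omega> i \<in> E}"
    have R: "?R \<in> sets P"
      using measurable_sets[OF reflected_code_at_measurable E, of i]
      by (simp add: vimage_def Int_def conj_commute)
    have "G \<in> sets ?tb" using sets.top[of ?tb] by (simp add: space_transition_borel)
    then have "env.prob ?S = env.prob {\<omega> \<in> space P. ?f \<omega> \<in> G}"
      using sym unfolding symmetric_env_def by (simp only:)
    also have "{\<omega> \<in> space P. ?f \<omega> \<in> G} = space P" using env_in_G by auto
    finally have S1: "env.prob ?S = 1" by (simp add: env.prob_space)
    \<comment> \<open>The value of \<open>measure\<close> outside the \<sigma>-algebra is 0, so the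
      value 1 forces measurability.\<close>
    then have S: "?S \<in> sets P" using measure_notin_sets by fastforce
    have NN: "?N (?N g) = g" if "g \<in> G" for g
      using that transition_functions by (intro neg_on_neg_on) (auto simp: transition_functions_def)
    have enc: "encode (?N g) = (\<lambda>b\<in>\<beta>. - encode g b)" for g
      using rep(2) by (auto simp: encode_def neg_on_def)
    have "?f \<omega> \<in> ?N ` A \<longleftrightarrow> ?f \<omega> \<in> ?N ` G \<and> reflected_code \<omega> i \<in> E" if "\<omega> \<in> space P" for \<omega>
    proof -
      have g: "?f \<omega> \<in> G" using env_in_G that by blast
      have rc: "reflected_code \<omega> i = encode (?N (?f \<omega>))"
        by (simp add: reflected_code_def code_def enc)
      have "?f \<omega> \<in> ?N ` A \<longleftrightarrow> ?N (?f \<omega>) \<in> A"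
        if "?f \<omega> \<in> ?N ` G"
      proof
        assume "?f \<omega> \<in> ?N ` A"
        then obtain h where "h \<in> A" "?f \<omega> = ?N h" by blast
        then show "?N (?f \<omega>) \<in> A" using NN[of h] by (simp add: A_def space_transition_borel)
      next
        assume "?N (?f \<omega>) \<in> A"
        then show "?f \<omega> \<in> ?N ` A" using NN[OF g] by (metis image_eqI)
      qed
      moreover have "?N ` A \<subseteq> ?N ` G" by (auto simp: A_def space_transition_borel)
      moreover have "?N (?f \<omega>) \<in> G" if "?f \<omega> \<in> ?N ` G"
        using that NN by auto
      ultimately show ?thesis
        unfolding rc by (auto simp: A_def space_transition_borel)
    qed
    then have "{\<omega> \<in> space P. ?f \<omega> \<in> ?N ` A} = ?S \<inter> ?R" by blast
    then have "env.prob {\<omega> \<in> space P. ?f \<omega> \<in> ?N ` A} = env.prob (?S \<inter> ?R)" by simp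
    also have "\<dots> = env.prob ?R"
      using env.AE_prob_1[OF S1] S R by (intro env.finite_measure_eq_AE) auto
    finally have "env.prob ?R = env.prob {\<omega> \<in> space P. ?f \<omega> \<in> A}"
      using sym A unfolding symmetric_env_def by (simp only:)
    also have "{\<omega> \<in> space P. ?f \<omega> \<in> A} = {\<omega> \<in> space P. code \<omega> (- i) \<in> E}"
      using env_in_G by (auto simp: A_def space_transition_borel code_def)
    finally show "emeasure (distr P code_fun (\<lambda>\<omega>. reflected_code \<omega> i)) E =
        emeasure (distr P code_fun (\<lambda>\<omega>. code \<omega> (- i))) E"
      using E by (simp add: emeasure_distr reflected_code_at_measurable code_at_measurable
          env.emeasure_eq_measure vimage_def Int_def conj_commute)
  qed simp
  ultimately show ?thesis by simp
qed

lemma distr_reflected_code: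
  assumes iid: "iid_env \<beta> \<alpha> G P \<eta> \<phi>" and sym: "symmetric_env (space M) \<beta> \<alpha> G P \<eta> \<phi>"
  shows "distr P code_env reflected_code = distr P code_env code"
proof -
  \<comment> \<open>Independence passes to codes, to the index map \<open>i\<close> to
    \<open>- i\<close> and to negation, so both joint laws are products of their marginals.\<close>
  have "env.indep_vars (\<lambda>_. transition_borel \<beta> \<alpha> G) (\<lambda>i \<omega>. env_at \<omega> i) UNIV"
    using iid by (simp add: iid_env_def)
  then have ind: "env.indep_vars (\<lambda>_. code_fun) (\<lambda>i \<omega>. code \<omega> i) UNIV"
    unfolding code_def by (rule env.indep_vars_compose2) (rule encode_measurable)
  then have "env.indep_vars (\<lambda>_. code_fun) (\<lambda>i \<omega>. code \<omega> (- i)) (UNIV :: int set)"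
    by (intro env.indep_vars_reindex[where h = uminus and M' = "\<lambda>_. code_fun" and X = "\<lambda>i \<omega>. code \<omega> i"])
      (simp_all add: surj_uminus)
  then have ind': "env.indep_vars (\<lambda>_. code_fun) (\<lambda>i \<omega>. reflected_code \<omega> i) UNIV"
    unfolding reflected_code_def by (rule env.indep_vars_compose2) (rule neg_code_measurable)
  have law: "distr P code_env (\<lambda>\<omega> i. Y i \<omega>) = PiM UNIV (\<lambda>i. distr P code_fun (Y i))"
    if Y: "env.indep_vars (\<lambda>_. code_fun) Y UNIV" for Y :: "int \<Rightarrow> 'w \<Rightarrow> 'x set \<Rightarrow> int"
  proof -
    have "env.random_variable code_fun (Y i)" for i using Y unfolding env.indep_vars_def2 by blast
    then have "distr P code_env (\<lambda>\<omega>. \<lambda>i\<in>UNIV. Y i \<omega>) = PiM UNIV (\<lambda>i. distr P code_fun (Y i))"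
      using env.indep_vars_iff_distr_eq_PiM'[where I = UNIV and M' = "\<lambda>_. code_fun" and X = Y] Y by blast
    then show ?thesis by (simp add: restrict_def)
  qed
  show ?thesis
    using law[OF ind] law[OF ind'] by (simp add: distr_reflected_code_at[OF iid sym])
qed

lemma decode_code: "\<omega> \<in> space P \<Longrightarrow> x \<in> space M \<Longrightarrow> decode (code \<omega>) i x = env_at \<omega> i x"
  by (simp add: decode_def code_def encode_cell env_in_G)

text \<open>Translation by 0 serves as a congruence rule, since the two environments are compared
  only on \<open>space M\<close>.\<close>

lemma bounded_above_code:
  assumes "\<omega> \<in> space P"
  shows "bounded_above M T (decode (code \<omega>)) i = bounded_above M T (env_at \<omega>) i"
  using bounded_above_translate[where g = "decode (code \<omega>)" and f = "env_at \<omega>" and k = 0]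
    decode_code[OF assms] by simp

lemma bounded_above_reflected_code:
  assumes "\<omega> \<in> space P"
  shows "bounded_above M T (decode (reflected_code \<omega>)) i = bounded_below M T (env_at \<omega>) (- i)"
proof (rule bounded_above_reflect)
  fix i x assume x: "x \<in> space M"
  have "decode (reflected_code \<omega>) i x = - decode (code \<omega>) (- i) x"
    using cell(1)[OF x] by (simp add: decode_def reflected_code_def)
  then show "decode (reflected_code \<omega>) i x = - env_at \<omega> (- i) x"
    by (simp add: decode_code[OF assms x])
qed

lemma env_at_shift:
  assumes \<omega>: "\<omega> \<in> space P" shows "env_at (\<eta> \<omega>) i = env_at \<omega> (i + 1)"
proof -
  let ?W = "space P"
  have bij: "inv_into ?W \<eta> (\<eta> \<omega>) = \<omega>"
    using invertible \<omega> by (auto simp: invertible_transformation_def bij_betw_def intro: inv_into_f_f)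
  have "int_iterate ?W \<eta> i (\<eta> \<omega>) = int_iterate ?W \<eta> (i + 1) \<omega>"
  proof (cases "i \<ge> 0")
    case True
    then have "nat (i + 1) = Suc (nat i)" by simp
    then show ?thesis using True by (simp add: int_iterate_def funpow_swap1)
  next
    case False
    define n where "n = nat (- i - 1)"
    then have n: "nat (- i) = Suc n" "n = nat (- (i + 1))" using False by auto
    have "int_iterate ?W \<eta> i (\<eta> \<omega>) = (inv_into ?W \<eta> ^^ n) \<omega>"
      using False n(1) by (simp add: int_iterate_def funpow_swap1 bij)
    also have "\<dots> = int_iterate ?W \<eta> (i + 1) \<omega>"
      \<comment> \<open>At \<open>i = -1\<close> the new index is 0, where
        \<open>int_iterate\<close> passes from inverse to forward powers; both are the identity
        there.\<close>
      using False n(2) by (cases "i = -1") (auto simp: int_iterate_def)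
    finally show ?thesis .
  qed
  then show ?thesis by (simp add: env_def)
qed

lemma \<eta>_measurable: "\<eta> \<in> measurable P P"
  using invertible by (simp add: invertible_transformation_def)

lemma env_at_shift_iter:
  assumes \<omega>: "\<omega> \<in> space P" shows "env_at ((\<eta> ^^ k) \<omega>) i = env_at \<omega> (i + int k)"
proof (induction k arbitrary: i)
  case (Suc k)
  have "(\<eta> ^^ k) \<omega> \<in> space P"
    using measurable_space[OF funpow_measurable[OF \<eta>_measurable] \<omega>] .
  then show ?case using Suc by (simp add: env_at_shift algebra_simps)
qed simp

lemma bounded_above_shift_iter:
  "\<omega> \<in> space P \<Longrightarrow>
    bounded_above M T (env_at ((\<eta> ^^ k) \<omega>)) i = bounded_above M T (env_at \<omega>) (i + int k)"
  by (rule bounded_above_translate) (simp add: env_at_shift_iter)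

text \<open>The quantifier over starting sites makes this set strictly shift-invariant, as
  \<open>ergodic_env\<close> requires. In an irreducible environment one such site yields
  all.\<close>

definition right_bounded_envs :: "'w set" where
  "right_bounded_envs = {\<omega> \<in> space P. \<exists>i. prob (bounded_above M T (env_at \<omega>) i) > 0}"

definition left_bounded_envs :: "'w set" where
  "left_bounded_envs = {\<omega> \<in> space P. \<exists>i. prob (bounded_below M T (env_at \<omega>) i) > 0}"

text \<open>Both sets are preimages of one measurable set of arrays, under \<open>code\<close> and
  \<open>reflected_code\<close>; these two maps have the same law.\<close>

lemma right_bounded_sets: "right_bounded_envs \<in> sets P"
  and left_bounded_sets: "left_bounded_envs \<in> sets P"
  and prob_left_bounded:
    "iid_env \<beta> \<alpha> G P \<eta> \<phi> \<Longrightarrow> symmetric_env (space M) \<beta> \<alpha> G P \<eta> \<phi> \<Longrightarrow>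
      env.prob left_bounded_envs = env.prob right_bounded_envs"
proof -
  define B where "B = {F \<in> space code_env. \<exists>i. emeasure M (bounded_above M T (decode F) i) > 0}"
  have [measurable]: "(\<lambda>F. emeasure M (bounded_above M T (decode F) i)) \<in> borel_measurable code_env" for i
  proof -
    have "space M \<inter> bounded_above M T f i = bounded_above M T f i" for f
      by (auto simp: bounded_above_def)
    then show ?thesis using bounded_above_decode_measurable[OF sets.top, of i] by simp
  qed
  have B: "B \<in> sets code_env" unfolding B_def by measurable
  have r: "right_bounded_envs = code -` B \<inter> space P"
    using measurable_space[OF code_measurable]
    by (auto simp: right_bounded_envs_def B_def bounded_above_code emeasure_eq_measure)
  have l: "left_bounded_envs = reflected_code -` B \<inter> space P"
  proof -
    have "(\<exists>i. Q (- i)) \<longleftrightarrow> (\<exists>i. Q i)" for Q :: "int \<Rightarrow> bool" by (metis minus_minus)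
    then have "reflected_code \<omega> \<in> B \<longleftrightarrow> \<omega> \<in> left_bounded_envs" if "\<omega> \<in> space P" for \<omega>
      using measurable_space[OF reflected_code_measurable that] that
      by (simp add: left_bounded_envs_def B_def bounded_above_reflected_code emeasure_eq_measure)
    then show ?thesis by (auto simp: left_bounded_envs_def)
  qed
  show "right_bounded_envs \<in> sets P" "left_bounded_envs \<in> sets P"
    unfolding r l by (rule measurable_sets[OF code_measurable B] measurable_sets[OF reflected_code_measurable B])+
  show "env.prob left_bounded_envs = env.prob right_bounded_envs"
    if "iid_env \<beta> \<alpha> G P \<eta> \<phi>" "symmetric_env (space M) \<beta> \<alpha> G P \<eta> \<phi>"
    using distr_reflected_code[OF that] measure_distr[OF code_measurable B]
      measure_distr[OF reflected_code_measurable B] by (simp add: r l)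
qed

lemma right_bounded_invariant: "\<eta> -` right_bounded_envs \<inter> space P = right_bounded_envs"
proof -
  have "(\<exists>i. prob (bounded_above M T (env_at (\<eta> \<omega>)) i) > 0) \<longleftrightarrow>
      (\<exists>i. prob (bounded_above M T (env_at \<omega>) i) > 0)" if "\<omega> \<in> space P" for \<omega>
  proof -
    have "bounded_above M T (env_at (\<eta> \<omega>)) i = bounded_above M T (env_at \<omega>) (i + 1)" for i
      using bounded_above_shift_iter[OF that, of 1 i] by simp
    then show ?thesis by (metis diff_add_cancel)
  qed
  then show ?thesis
    using measurable_space[OF \<eta>_measurable] by (auto simp: right_bounded_envs_def)
qed

lemma quenched_walk_AE:
  assumes irr: "irreducible_dwde M T \<beta> P \<eta> \<phi>" and L: "\<forall>g\<in>G. \<forall>x\<in>space M. \<bar>g x\<bar> \<le> L"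
  shows "AE \<omega> in P. quenched_walk M T \<beta> (env_at \<omega>) L"
  using irr[unfolded irreducible_dwde_def] AE_space
proof eventually_elim
  case (elim \<omega>)
  show ?case
  proof
    show "env_at \<omega> i constant_on b" if "b \<in> \<beta>" for i b
      using constant_on_partition[OF env_in_G that] elim(2) by blast
    show "\<bar>env_at \<omega> i x\<bar> \<le> L" if "x \<in> space M" for i x
      using L env_in_G[OF elim(2)] that by blast
  qed (use elim(1) in blast)
qed

text \<open>Full measure would make almost every walk unbounded below, so
  \<open>left_bounded_envs\<close> would be null, whereas symmetry gives it the same
  probability.\<close>

lemma prob_right_bounded_ne_1:
  assumes irr: "irreducible_dwde M T \<beta> P \<eta> \<phi>" and L: "\<forall>g\<in>G. \<forall>x\<in>space M. \<bar>g x\<bar> \<le> L"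
    and erg: "ergodic_env P \<eta>" and stat: "stationary_env P \<eta>"
    and iid: "iid_env \<beta> \<alpha> G P \<eta> \<phi>" and sym: "symmetric_env (space M) \<beta> \<alpha> G P \<eta> \<phi>"
  shows "env.prob right_bounded_envs \<noteq> 1"
proof
  assume one: "env.prob right_bounded_envs = 1"
  let ?e = "\<lambda>n::nat. inverse (real (Suc n))"
  \<comment> \<open>Environments whose window at the origin satisfies the bound needed in
    \<open>AE_unbounded_below\<close> with a fixed constant. If
    \<open>(\<eta> ^^ k) \<omega>\<close> is such an environment, the window of \<omega> starting at
    \<open>k\<close> satisfies it.\<close>
  define \<Gamma> where "\<Gamma> = (\<lambda>n. {\<omega> \<in> space P. \<forall>i\<in>{0..L}. \<forall>b\<in>net. ?e n \<le> prob (b \<inter> bounded_above M T (env_at \<omega>) i)})"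
  have \<Gamma>_sets: "\<Gamma> n \<in> sets P" for n
  proof -
    have [measurable]: "(\<lambda>\<omega>. prob (b \<inter> bounded_above M T (env_at \<omega>) i)) \<in> borel_measurable P"
      if "b \<in> net" for b i
    proof -
      have "b \<in> sets M" using that net(1) partition_sets by blast
      from measurable_compose[OF code_measurable bounded_above_decode_measurable[OF this]]
      have "(\<lambda>\<omega>. enn2real (emeasure M (b \<inter> bounded_above M T (decode (code \<omega>)) i))) \<in> borel_measurable P"
        by measurable
      then show ?thesis by (simp add: bounded_above_code measure_def cong: measurable_cong)
    qed
    show ?thesis unfolding \<Gamma>_def using net(2) by measurable
  qed
  have "AE \<omega> in P. \<exists>n. \<omega> \<in> \<Gamma> n"
    using env.AE_prob_1[OF one] quenched_walk_AE[OF irr L] AE_space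
  proof eventually_elim
    case (elim \<omega>)
    interpret Q: quenched_walk M T \<beta> "env_at \<omega>" L by (rule elim)
    obtain i where i: "prob (bounded_above M T (env_at \<omega>) i) > 0"
      using elim(1) by (auto simp: right_bounded_envs_def)
    let ?S = "insert 1 ((\<lambda>(p, b). prob (b \<inter> bounded_above M T (env_at \<omega>) p)) ` ({0..L} \<times> net))"
    have fin: "finite ?S" using net(2) by simp
    have "0 < Min ?S"
      \<comment> \<open>Positivity at one site spreads to all sites of the window and all members of
        \<open>net\<close>; finitely many positive numbers have a positive minimum.\<close>
      using fin Q.prob_bounded_above_pos[OF i] net(1) by (subst Min_gr_iff) auto
    then obtain n where n: "?e n < Min ?S" using reals_Archimedean by blast
    have "?e n \<le> prob (b \<inter> bounded_above M T (env_at \<omega>) p)" if "p \<in> {0..L}" "b \<in> net" for p b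
    proof -
      have "Min ?S \<le> prob (b \<inter> bounded_above M T (env_at \<omega>) p)"
        using fin that by (intro Min_le) auto
      with n show ?thesis by linarith
    qed
    then show ?case using elim(3) unfolding \<Gamma>_def by blast
  qed
  have "\<exists>n. env.prob (\<Gamma> n) \<noteq> 0"
  proof (rule ccontr)
    assume "\<not> ?thesis"
    then have "AE \<omega> in P. \<omega> \<notin> (\<Union>n. \<Gamma> n)"
      using \<Gamma>_sets by (intro AE_not_in null_sets_UN) (auto simp: null_sets_def env.emeasure_eq_measure)
    with \<open>AE \<omega> in P. \<exists>n. \<omega> \<in> \<Gamma> n\<close> have "AE \<omega> in P. False" by eventually_elim blast
    then show False by simp
  qed
  then obtain n where "env.prob (\<Gamma> n) \<noteq> 0" by blast
  then have "env.prob (\<Gamma> n) > 0" by (simp add: zero_less_measure_iff)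
  then have rec: "AE \<omega> in P. \<exists>\<^sub>\<infinity>k. (\<eta> ^^ k) \<omega> \<in> \<Gamma> n"
    by (rule env.ergodic_recurrence[OF \<eta>_measurable erg stat \<Gamma>_sets])
  have "AE \<omega> in P. \<omega> \<notin> left_bounded_envs"
    using rec quenched_walk_AE[OF irr L] AE_space
  proof eventually_elim
    case (elim \<omega>)
    interpret Q: quenched_walk M T \<beta> "env_at \<omega>" L by (rule elim)
    have "AE x in M. x \<notin> bounded_below M T (env_at \<omega>) p" for p
    proof (rule Q.AE_unbounded_below)
      show "infinite {k. (\<eta> ^^ k) \<omega> \<in> \<Gamma> n}" using elim(1) by (simp add: frequently_cofinite)
      show "?e n > 0" by simp
      fix k i b assume "k \<in> {k. (\<eta> ^^ k) \<omega> \<in> \<Gamma> n}" "i \<in> {0..L}" "b \<in> net"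
      then show "?e n \<le> prob (b \<inter> bounded_above M T (env_at \<omega>) (int k + i))"
        by (auto simp: \<Gamma>_def bounded_above_shift_iter[OF elim(3)] add.commute)
    qed
    then have "prob (bounded_below M T (env_at \<omega>) p) = 0" for p
      using Q.bounded_sets(2) by (subst prob_eq_0) auto
    then show ?case by (simp add: left_bounded_envs_def)
  qed
  then have "env.prob left_bounded_envs = 0"
    using left_bounded_sets by (subst env.prob_eq_0) auto
  then show False using prob_left_bounded[OF iid sym] one by simp
qed

end

theorem corollary5p21:
  fixes M :: "'x measure" and T :: "'x \<Rightarrow> 'x" and \<beta> :: "'x set set"
    and P :: "'w measure" and \<alpha> :: "nat \<Rightarrow> 'x set" and G :: "('x \<Rightarrow> int) set"
    and \<eta> :: "'w \<Rightarrow> 'w" and \<phi> :: "'w \<Rightarrow> 'x \<Rightarrow> int"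
  assumes "dwde M T \<beta> P \<alpha> G \<eta> \<phi>"
    and "linkage_property M T \<beta> P \<eta> \<phi>"
    and "uniformly_bounded_jumps (space M) G"
    and "ergodic_env P \<eta>" and "stationary_env P \<eta>"
    and "iid_env \<beta> \<alpha> G P \<eta> \<phi>"
    and "symmetric_env (space M) \<beta> \<alpha> G P \<eta> \<phi>"
  shows "transitive_dwde M T P \<eta> \<phi>"
proof -
  interpret dwde M T \<beta> P \<alpha> G \<eta> \<phi> by (rule assms(1))
  have irr: "irreducible_dwde M T \<beta> P \<eta> \<phi>" using assms(2) by (simp add: linkage_property_def)
  obtain J where J: "finite J" "\<And>g. g \<in> G \<Longrightarrow> g ` space M \<subseteq> J"
    using assms(3) by (auto simp: uniformly_bounded_jumps_def)
  define L where "L = Max (abs ` J)"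
  have L: "\<forall>g\<in>G. \<forall>x\<in>space M. \<bar>g x\<bar> \<le> L"
    unfolding L_def using J by (intro ballI Max_ge) auto
  have "env.prob right_bounded_envs \<noteq> 1"
    using prob_right_bounded_ne_1[OF irr L] assms by blast
  \<comment> \<open>The set is invariant, so ergodicity excludes every probability except 0 and
    1.\<close>
  then have r0: "env.prob right_bounded_envs = 0"
    using assms(4) right_bounded_sets right_bounded_invariant unfolding ergodic_env_def by blast
  then have l0: "env.prob left_bounded_envs = 0"
    using prob_left_bounded assms(6,7) by simp
  have "AE \<omega> in P. \<omega> \<notin> right_bounded_envs" "AE \<omega> in P. \<omega> \<notin> left_bounded_envs"
    using r0 l0 right_bounded_sets left_bounded_sets env.prob_eq_0 by blast+
  then have "AE \<omega> in P. \<forall>i j. measure M {x \<in> space M. \<exists>n\<ge>1. walk T (env P \<eta> \<phi> \<omega>) i n x = j} = 1"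
    using quenched_walk_AE[OF irr L] AE_space
  proof eventually_elim
    case (elim \<omega>)
    interpret Q: quenched_walk M T \<beta> "env_at \<omega>" L by (rule elim)
    have "prob (bounded_above M T (env_at \<omega>) i) = 0" "prob (bounded_below M T (env_at \<omega>) i) = 0" for i
      using elim by (auto simp: right_bounded_envs_def left_bounded_envs_def zero_less_measure_iff)
    then have "AE x in M. x \<notin> bounded_above M T (env_at \<omega>) i" "AE x in M. x \<notin> bounded_below M T (env_at \<omega>) i" for i
      using prob_eq_0[OF Q.bounded_sets(1)] prob_eq_0[OF Q.bounded_sets(2)] by blast+
    \<comment> \<open>Outside both null sets the walk from every site is almost surely unbounded in
      both directions, as \<open>AE_hit\<close> requires.\<close>
    then have "prob (hit M T (env_at \<omega>) i {j}) = 1" for i j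
      using Q.AE_hit prob_eq_1[OF Q.hit_sets] by blast
    then show ?case by (simp add: hit_def)
  qed
  then show ?thesis by (simp add: transitive_dwde_def)
qed

end
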